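(* Let $1\le p,q\le\infty$ and let $\alpha:[0,1]\to[0,\infty)$ be measurable with $\alpha_0:=\inf_{t\in[0,1]}\alpha(t)>\left(\frac1p-\frac1q\right)_+$. Then the operator $R^{\alpha(\cdot)}$ is compact from $L_p[0,1]$ into $L_q[0,1]$.
   Context: For a measurable function $\alpha:[0,1]\to[0,\infty)$ with $\alpha(t)>0$ for almost every $t$, the Riemann--Liouville operator of variable order is $$(R^{\alpha(\cdot)}f)(t):=\frac{1}{\Gamma(\alpha(t))}\int_0^t (t-s)^{\alpha(t)-1}f(s)\,ds,\qquad t\in[0,1],$$ for $f\in L_1[0,1]$ (the integral exists for almost every $t$). Here $x_+=\max\{x,0\}$ and $1/\infty=0$. *)

theory Defs
  imports "HOL-Analysis.Analysis" "HOL-Probability.Essential_Supremum"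
begin

text \<open>Real-valued \<open>L\<^sub>p\<close> spaces over a measure, for an extended real exponent \<open>1 \<le> p \<le> \<infinity>\<close>.\<close>

definition lp_space :: "'a measure \<Rightarrow> ereal \<Rightarrow> ('a \<Rightarrow> real) set" where
  "lp_space M p = {f \<in> borel_measurable M.
     if p = \<infinity> then esssup M (\<lambda>x. ereal \<bar>f x\<bar>) < \<infinity>
     else integrable M (\<lambda>x. \<bar>f x\<bar> powr real_of_ereal p)}"

definition lp_norm :: "'a measure \<Rightarrow> ereal \<Rightarrow> ('a \<Rightarrow> real) \<Rightarrow> real" where
  "lp_norm M p f =
     (if p = \<infinity> then real_of_ereal (esssup M (\<lambda>x. ereal \<bar>f x\<bar>))
      else (\<integral>x. \<bar>f x\<bar> powr real_of_ereal p \<partial>M) powr (1 / real_of_ereal p))"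

definition ae_eq :: "'a measure \<Rightarrow> ereal \<Rightarrow> (('a \<Rightarrow> real) \<times> ('a \<Rightarrow> real)) set" where
  "ae_eq M p = {(f, g). f \<in> lp_space M p \<and> g \<in> lp_space M p \<and> (AE x in M. f x = g x)}"

definition Lp :: "'a measure \<Rightarrow> ereal \<Rightarrow> ('a \<Rightarrow> real) set set" where
  "Lp M p = lp_space M p // ae_eq M p"

definition Lp_class :: "'a measure \<Rightarrow> ereal \<Rightarrow> ('a \<Rightarrow> real) \<Rightarrow> ('a \<Rightarrow> real) set" where
  "Lp_class M p f = ae_eq M p `` {f}"

definition Lp_dist :: "'a measure \<Rightarrow> ereal \<Rightarrow> ('a \<Rightarrow> real) set \<Rightarrow> ('a \<Rightarrow> real) set \<Rightarrow> real" where
  "Lp_dist M p F G = lp_norm M p (\<lambda>x. (SOME f. f \<in> F) x - (SOME g. g \<in> G) x)"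

lemma equiv_ae_eq: "equiv (lp_space M p) (ae_eq M p)"
proof (rule equivI)
  show "trans (ae_eq M p)"
  proof (rule transI)
    fix f g h assume "(f, g) \<in> ae_eq M p" "(g, h) \<in> ae_eq M p"
    then show "(f, h) \<in> ae_eq M p"
      by (auto simp: ae_eq_def elim: AE_mp)
  qed
qed (auto simp: ae_eq_def refl_on_def sym_def elim: AE_mp)

lemma lp_space_measurable: "f \<in> lp_space M p \<Longrightarrow> f \<in> borel_measurable M"
  by (simp add: lp_space_def)

lemma lp_norm_nonneg: "0 \<le> lp_norm M p f"
proof (cases "p = \<infinity>")
  case True
  have "esssup M (\<lambda>x. ereal \<bar>f x\<bar>) = - \<infinity> \<or> 0 \<le> esssup M (\<lambda>x. ereal \<bar>f x\<bar>)"
  proof (cases "emeasure M (space M) = 0")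
    case True
    show ?thesis
    proof (cases "(\<lambda>x. ereal \<bar>f x\<bar>) \<in> borel_measurable M")
      case True
      then show ?thesis using \<open>emeasure M (space M) = 0\<close>
        by (simp add: esssup_def ae_filter_eq_bot_iff[THEN iffD2] Limsup_bot bot_ereal_def)
    qed (simp add: esssup_non_measurable top_ereal_def)
  next
    case False
    have "esssup M (\<lambda>x. 0::ereal) \<le> esssup M (\<lambda>x. ereal \<bar>f x\<bar>)"
      by (rule esssup_mono) auto
    then show ?thesis using esssup_const[OF False] by metis
  qed
  with True show ?thesis
    by (auto simp: lp_norm_def real_of_ereal_pos)
qed (simp add: lp_norm_def)


lemma lp_space_PInf_AE:
  assumes "f \<in> lp_space M \<infinity>"
  shows "AE x in M. \<bar>f x\<bar> \<le> lp_norm M \<infinity> f"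
proof -
  let ?e = "esssup M (\<lambda>x. ereal \<bar>f x\<bar>)"
  have fin: "?e < \<infinity>" using assms by (simp add: lp_space_def)
  have "AE x in M. ereal \<bar>f x\<bar> \<le> ?e" by (rule esssup_AE)
  then show ?thesis
  proof (rule AE_mp, intro AE_I2 impI)
    fix x assume le: "ereal \<bar>f x\<bar> \<le> ?e"
    with fin obtain r where "?e = ereal r" by (cases ?e) auto
    with le show "\<bar>f x\<bar> \<le> lp_norm M \<infinity> f" by (simp add: lp_norm_def)
  qed
qed

lemma lp_norm_PInf_leI:
  assumes [measurable]: "f \<in> borel_measurable M" and le: "AE x in M. \<bar>f x\<bar> \<le> c" and "0 \<le> c"
  shows "f \<in> lp_space M \<infinity>" "lp_norm M \<infinity> f \<le> c"
proof -
  let ?e = "esssup M (\<lambda>x. ereal \<bar>f x\<bar>)"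
  have le: "?e \<le> ereal c" using le by (intro esssup_I) auto
  then show "f \<in> lp_space M \<infinity>" by (auto simp: lp_space_def)
  from le \<open>0 \<le> c\<close> show "lp_norm M \<infinity> f \<le> c" by (cases ?e) (auto simp: lp_norm_def)
qed

lemma powr_convex_comb:
  fixes a b :: real
  assumes "0 \<le> a" "0 \<le> b" "0 < l" "l < 1" "1 \<le> r"
  shows "(l * a + (1 - l) * b) powr r \<le> l * a powr r + (1 - l) * b powr r"
proof -
  have scale: "(m * y) powr r \<le> m * y powr r" if "0 < m" "m < 1" "0 \<le> y" for m y :: real
  proof -
    have "m powr r \<le> m powr 1" using that assms by (intro powr_mono') auto
    then show ?thesis using that by (simp add: powr_mult mult_right_mono)
  qed
  show ?thesis
  proof (cases "a = 0 \<or> b = 0")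
    case True
    then show ?thesis using scale[of l a] scale[of "1 - l" b] assms by auto
  next
    case False
    then show ?thesis
      using convex_onD[OF powr_convex[OF \<open>1 \<le> r\<close>], of "1 - l" a b] assms by simp
  qed
qed

lemma lp_space_diff:
  assumes p: "1 \<le> p" and f: "f \<in> lp_space M p" and g: "g \<in> lp_space M p"
  shows "(\<lambda>x. f x - g x) \<in> lp_space M p"
    and "lp_norm M p (\<lambda>x. f x - g x) \<le> lp_norm M p f + lp_norm M p g"
proof -
  note [measurable] = lp_space_measurable[OF f] lp_space_measurable[OF g]
  have "(\<lambda>x. f x - g x) \<in> lp_space M p \<and>
    lp_norm M p (\<lambda>x. f x - g x) \<le> lp_norm M p f + lp_norm M p g"
  proof (cases "p = \<infinity>")
    case True
    have "AE x in M. \<bar>f x - g x\<bar> \<le> lp_norm M \<infinity> f + lp_norm M \<infinity> g"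
      using lp_space_PInf_AE[OF f[unfolded True]] lp_space_PInf_AE[OF g[unfolded True]]
      by eventually_elim linarith
    then show ?thesis
      using lp_norm_PInf_leI[of "\<lambda>x. f x - g x" M "lp_norm M \<infinity> f + lp_norm M \<infinity> g"]
        lp_norm_nonneg[of M \<infinity> f] lp_norm_nonneg[of M \<infinity> g] True by auto
  next
    case False
    with p obtain r where pr: "p = ereal r" and r: "1 \<le> r" by (cases p) (auto simp: one_ereal_def)
    have intf: "integrable M (\<lambda>x. \<bar>f x\<bar> powr r)" and intg: "integrable M (\<lambda>x. \<bar>g x\<bar> powr r)"
      using f g by (auto simp: lp_space_def pr)
    have pt: "\<bar>f x - g x\<bar> powr r
        \<le> (u + v) powr r * (u / (u + v) * (\<bar>f x\<bar> powr r / u powr r) + v / (u + v) * (\<bar>g x\<bar> powr r / v powr r))"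
      if "0 < u" "0 < v" for u v x
    proof -
      have e: "1 - u / (u + v) = v / (u + v)" using that by (simp add: field_simps)
      have "(u + v) * (u / (u + v) * (\<bar>f x\<bar> / u) + v / (u + v) * (\<bar>g x\<bar> / v)) = \<bar>f x\<bar> + \<bar>g x\<bar>"
        using that by (simp add: distrib_left)
      then have "\<bar>f x - g x\<bar> powr r
          \<le> ((u + v) * (u / (u + v) * (\<bar>f x\<bar> / u) + v / (u + v) * (\<bar>g x\<bar> / v))) powr r"
        using r by (intro powr_mono2) auto
      also have "\<dots> = (u + v) powr r * (u / (u + v) * (\<bar>f x\<bar> / u) + v / (u + v) * (\<bar>g x\<bar> / v)) powr r"
        using that by (subst powr_mult) auto
      also have "\<dots> \<le> (u + v) powr r * (u / (u + v) * (\<bar>f x\<bar> / u) powr r + v / (u + v) * (\<bar>g x\<bar> / v) powr r)"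
        using powr_convex_comb[of "\<bar>f x\<bar> / u" "\<bar>g x\<bar> / v" "u / (u + v)" r] that r
        unfolding e by (intro mult_left_mono) auto
      finally show ?thesis using that by (simp add: powr_divide)
    qed
    have intd: "integrable M (\<lambda>x. \<bar>f x - g x\<bar> powr r)"
    proof (rule Bochner_Integration.integrable_bound)
      show "integrable M (\<lambda>x. (1 + 1) powr r * (1 / (1 + 1) * (\<bar>f x\<bar> powr r / 1 powr r) + 1 / (1 + 1) * (\<bar>g x\<bar> powr r / 1 powr r)))"
        using intf intg by simp
      show "AE x in M. norm (\<bar>f x - g x\<bar> powr r) \<le>
          norm ((1 + 1) powr r * (1 / (1 + 1) * (\<bar>f x\<bar> powr r / 1 powr r) + 1 / (1 + 1) * (\<bar>g x\<bar> powr r / 1 powr r)))"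
        using pt[of 1 1] by (intro AE_I2) (smt (verit) powr_ge_zero real_norm_def)
    qed simp
    have lpr: "lp_norm M p h = (\<integral>x. \<bar>h x\<bar> powr r \<partial>M) powr (1 / r)" for h
      by (simp add: lp_norm_def pr)
    have I: "(\<integral>x. \<bar>h x\<bar> powr r \<partial>M) \<le> u powr r" if "lp_norm M p h < u" for h u
    proof -
      have "lp_norm M p h powr r \<le> u powr r"
        using that r lp_norm_nonneg[of M p h] by (intro powr_mono2) auto
      then show ?thesis using r by (simp add: lpr powr_powr)
    qed
    have "lp_norm M p (\<lambda>x. f x - g x) \<le> u + v" if u: "lp_norm M p f < u" and v: "lp_norm M p g < v" for u v
    proof -
      have pos: "0 < u" "0 < v" using u v lp_norm_nonneg[of M p f] lp_norm_nonneg[of M p g] by auto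
      have "(\<integral>x. \<bar>f x - g x\<bar> powr r \<partial>M) \<le>
        (\<integral>x. (u + v) powr r * (u / (u + v) * (\<bar>f x\<bar> powr r / u powr r) + v / (u + v) * (\<bar>g x\<bar> powr r / v powr r)) \<partial>M)"
        using pt[OF pos] intd intf intg by (intro integral_mono) auto
      also have "\<dots> = (u + v) powr r * (u / (u + v) * ((\<integral>x. \<bar>f x\<bar> powr r \<partial>M) / u powr r)
          + v / (u + v) * ((\<integral>x. \<bar>g x\<bar> powr r \<partial>M) / v powr r))"
        using intf intg by simp
      also have "\<dots> \<le> (u + v) powr r * (u / (u + v) * 1 + v / (u + v) * 1)"
        using I[OF u] I[OF v] pos by (intro mult_left_mono add_mono) auto
      also have "\<dots> = (u + v) powr r" using pos by (simp add: add_divide_distrib[symmetric])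
      finally have "lp_norm M p (\<lambda>x. f x - g x) \<le> ((u + v) powr r) powr (1 / r)"
        unfolding lpr using r by (intro powr_mono2) auto
      then show ?thesis using pos r by (simp add: powr_powr)
    qed
    note tri = this
    have "lp_norm M p (\<lambda>x. f x - g x) \<le> lp_norm M p f + lp_norm M p g"
    proof (rule field_le_epsilon)
      fix e :: real assume "0 < e"
      then show "lp_norm M p (\<lambda>x. f x - g x) \<le> lp_norm M p f + lp_norm M p g + e"
        using tri[of "lp_norm M p f + e / 2" "lp_norm M p g + e / 2"] by simp
    qed
    with intd show ?thesis by (simp add: lp_space_def pr)
  qed
  then show "(\<lambda>x. f x - g x) \<in> lp_space M p"
    "lp_norm M p (\<lambda>x. f x - g x) \<le> lp_norm M p f + lp_norm M p g" by auto
qed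

lemma lp_norm_cong_AE:
  assumes [measurable]: "f \<in> borel_measurable M" "g \<in> borel_measurable M"
    and eq: "AE x in M. f x = g x"
  shows "lp_norm M p f = lp_norm M p g"
proof -
  have "esssup M (\<lambda>x. ereal \<bar>f x\<bar>) = esssup M (\<lambda>x. ereal \<bar>g x\<bar>)"
    using eq by (intro esssup_AE_cong) auto
  moreover have "(\<integral>x. \<bar>f x\<bar> powr real_of_ereal p \<partial>M) = (\<integral>x. \<bar>g x\<bar> powr real_of_ereal p \<partial>M)"
    using eq by (intro integral_cong_AE) auto
  ultimately show ?thesis by (simp add: lp_norm_def)
qed

lemma lp_norm_eq_0_AE:
  assumes p: "1 \<le> p" and f: "f \<in> lp_space M p"
  shows "lp_norm M p f = 0 \<longleftrightarrow> (AE x in M. f x = 0)"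
proof
  note [measurable] = lp_space_measurable[OF f]
  assume 0: "lp_norm M p f = 0"
  show "AE x in M. f x = 0"
  proof (cases "p = \<infinity>")
    case True
    then show ?thesis using lp_space_PInf_AE[OF f[unfolded True]] 0 by simp
  next
    case False
    with f have "integrable M (\<lambda>x. \<bar>f x\<bar> powr real_of_ereal p)" by (simp add: lp_space_def)
    moreover have "(\<integral>x. \<bar>f x\<bar> powr real_of_ereal p \<partial>M) = 0"
      using 0 False by (simp add: lp_norm_def)
    ultimately have "AE x in M. \<bar>f x\<bar> powr real_of_ereal p = 0"
      using integral_nonneg_eq_0_iff_AE[of M "\<lambda>x. \<bar>f x\<bar> powr real_of_ereal p"] by simp
    then show ?thesis by simp
  qed
next
  note [measurable] = lp_space_measurable[OF f]
  assume "AE x in M. f x = 0"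
  then have "lp_norm M p f = lp_norm M p (\<lambda>x. 0)" by (intro lp_norm_cong_AE) auto
  moreover have "lp_norm M p (\<lambda>x. 0) = 0"
  proof (cases "p = \<infinity>")
    case True
    then show ?thesis
      using lp_norm_PInf_leI(2)[of "\<lambda>x. 0" M 0] lp_norm_nonneg[of M \<infinity> "\<lambda>x. 0"] by simp
  qed (simp add: lp_norm_def)
  ultimately show "lp_norm M p f = 0" by simp
qed

lemma Lp_class_in_Lp: "f \<in> lp_space M p \<Longrightarrow> Lp_class M p f \<in> Lp M p"
  by (simp add: Lp_def Lp_class_def quotientI)

lemma Lp_dist_class:
  assumes p: "1 \<le> p" and f: "f \<in> lp_space M p" and g: "g \<in> lp_space M p"
  shows "Lp_dist M p (Lp_class M p f) (Lp_class M p g) = lp_norm M p (\<lambda>x. f x - g x)"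
proof -
  have ex: "\<exists>h. h \<in> Lp_class M p k" if "k \<in> lp_space M p" for k
    using that by (auto simp: Lp_class_def ae_eq_def)
  define f' where "f' = (SOME h. h \<in> Lp_class M p f)"
  define g' where "g' = (SOME h. h \<in> Lp_class M p g)"
  have "f' \<in> Lp_class M p f" "g' \<in> Lp_class M p g"
    unfolding f'_def g'_def by (rule someI_ex[OF ex[OF f]], rule someI_ex[OF ex[OF g]])
  then have f': "f' \<in> lp_space M p" "AE x in M. f x = f' x"
    and g': "g' \<in> lp_space M p" "AE x in M. g x = g' x"
    by (auto simp: Lp_class_def ae_eq_def)
  have "AE x in M. f' x - g' x = f x - g x"
    using f'(2) g'(2) by eventually_elim simp
  then have "lp_norm M p (\<lambda>x. f' x - g' x) = lp_norm M p (\<lambda>x. f x - g x)"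
    using f f' g g' by (intro lp_norm_cong_AE borel_measurable_diff lp_space_measurable) auto
  then show ?thesis by (simp add: Lp_dist_def f'_def g'_def)
qed

lemma Metric_space_Lp:
  assumes p: "1 \<le> p"
  shows "Metric_space (Lp M p) (Lp_dist M p)"
proof
  have rep: "\<exists>f\<in>lp_space M p. F = Lp_class M p f" if "F \<in> Lp M p" for F
    using that by (auto simp: Lp_def Lp_class_def elim: quotientE)
  show "0 \<le> Lp_dist M p F G" for F G
    by (simp add: Lp_dist_def lp_norm_nonneg)
  show "Lp_dist M p F G = Lp_dist M p G F" for F G
    unfolding Lp_dist_def lp_norm_def by (simp only: abs_minus_commute)
  show "Lp_dist M p F G = 0 \<longleftrightarrow> F = G" if "F \<in> Lp M p" "G \<in> Lp M p" for F G
  proof -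
    from rep that obtain f g where f: "f \<in> lp_space M p" "F = Lp_class M p f"
      and g: "g \<in> lp_space M p" "G = Lp_class M p g" by metis
    have "Lp_dist M p F G = 0 \<longleftrightarrow> (f, g) \<in> ae_eq M p"
      using f g by (simp add: Lp_dist_class[OF p] lp_norm_eq_0_AE[OF p] lp_space_diff[OF p] ae_eq_def)
    also have "\<dots> \<longleftrightarrow> F = G"
      using eq_equiv_class_iff[OF equiv_ae_eq f(1) g(1)] f g by (simp add: Lp_class_def)
    finally show ?thesis .
  qed
  show "Lp_dist M p F H \<le> Lp_dist M p F G + Lp_dist M p G H"
    if "F \<in> Lp M p" "G \<in> Lp M p" "H \<in> Lp M p" for F G H
  proof -
    from rep that obtain f g h where f: "f \<in> lp_space M p" "F = Lp_class M p f"
      and g: "g \<in> lp_space M p" "G = Lp_class M p g" and h: "h \<in> lp_space M p" "H = Lp_class M p h"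
      by metis
    have "lp_norm M p (\<lambda>x. (f x - g x) - (h x - g x))
        \<le> lp_norm M p (\<lambda>x. f x - g x) + lp_norm M p (\<lambda>x. h x - g x)"
      by (intro lp_space_diff p f g h)
    moreover have "lp_norm M p (\<lambda>x. h x - g x) = lp_norm M p (\<lambda>x. g x - h x)"
      unfolding lp_norm_def by (simp only: abs_minus_commute)
    ultimately show ?thesis using f g h by (simp add: Lp_dist_class[OF p])
  qed
qed

text \<open>A map \<open>T\<close> on functions is a compact operator from \<open>L\<^sub>p\<close> to \<open>L\<^sub>q\<close> if it induces a
  linear map between the spaces of classes which sends the closed unit ball to a
  relatively compact set.\<close>

definition compact_operator_Lp ::
    "'a measure \<Rightarrow> ereal \<Rightarrow> 'b measure \<Rightarrow> ereal \<Rightarrow> (('a \<Rightarrow> real) \<Rightarrow> ('b \<Rightarrow> real)) \<Rightarrow> bool" where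
  "compact_operator_Lp M p N q T \<longleftrightarrow>
     (\<forall>f\<in>lp_space M p. T f \<in> lp_space N q) \<and>
     (\<forall>f g. (f, g) \<in> ae_eq M p \<longrightarrow> (T f, T g) \<in> ae_eq N q) \<and>
     (\<forall>f\<in>lp_space M p. \<forall>g\<in>lp_space M p. \<forall>a b.
        AE t in N. T (\<lambda>x. a * f x + b * g x) t = a * T f t + b * T g t) \<and>
     (let X = Metric_space.mtopology (Lp N q) (Lp_dist N q) in
        compactin X (X closure_of
          {Lp_class N q (T f) | f. f \<in> lp_space M p \<and> lp_norm M p f \<le> 1}))"

text \<open>At points \<open>t\<close> where the integral does not exist (a null set for integrable \<open>f\<close> if
  \<open>\<alpha>\<close> is measurable and almost everywhere positive) the library convention makes the
  value \<open>0\<close>. The integrand is \<open>0\<close> at \<open>s = t\<close>, which is also a null set.\<close>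

definition RL_integral :: "(real \<Rightarrow> real) \<Rightarrow> (real \<Rightarrow> real) \<Rightarrow> real \<Rightarrow> real" where
  "RL_integral \<alpha> f t =
     1 / Gamma (\<alpha> t) * (LINT s:{0..t}|lebesgue. (t - s) powr (\<alpha> t - 1) * f s)"

end

theory Submission
  imports Defs "HOL-Probability.Probability_Measure"
begin

text \<open>
  Write \<open>u = t - s\<close>, let \<open>a0\<close> be the infimum of \<open>\<alpha>\<close>, and let \<open>1 \<le> p \<le> q\<close> with \<open>p\<close> finite. The
  kernel \<open>u powr (\<alpha> t - 1) / Gamma (\<alpha> t)\<close> is dominated on \<open>0 < u \<le> 1\<close> by a multiple of
  \<open>u powr (a0 - 1)\<close>, because \<open>1 / Gamma\<close> is bounded on the positive axis. So everything is
  controlled by the potential \<open>RL_potential a f t\<close>, the integral of \<open>(t - s) powr (a - 1) * \<bar>f s\<bar>\<close>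
  over \<open>s < t\<close>.

  The potential is bounded from \<open>L\<^sub>p\<close> into \<open>L\<^sub>q\<close> as soon as \<open>a > 1/p - 1/q\<close>
  (\<open>RL_potential_bounded\<close>). This follows from two applications of Jensen's inequality
  and Tonelli's theorem: Jensen with respect to a weight \<open>u powr (\<kappa> - 1)\<close> moves the exponent
  \<open>p\<close> into the integral, Jensen with respect to \<open>\<bar>f\<bar> powr p\<close> raises \<open>p\<close> to \<open>q\<close>, and the
  power of \<open>u\<close> that remains is integrable because \<open>a > 1/p - 1/q\<close> is strict.

  For compactness the singularity is cut off continuously at \<open>u \<approx> \<epsilon>\<close>. The removed part
  of the kernel is at most \<open>B * (2 * \<epsilon>) powr \<eta> * u powr (a0 - \<eta> - 1)\<close>, so for small \<open>\<eta>\<close> its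
  operator norm tends to \<open>0\<close> with \<open>\<epsilon>\<close>. The remaining kernel is Lipschitz in \<open>s\<close>, uniformly in
  \<open>t\<close> (even though \<open>\<alpha>\<close> need not be bounded above, since \<open>\<bar>x - 1\<bar> / Gamma x\<close> is bounded), so
  it is uniformly close to a kernel that is constant in \<open>s\<close> on each of the cells
  \<open>{s. \<lfloor>n * s\<rfloor> = j}\<close>. An operator with such a kernel sees only the cell integrals of \<open>f\<close>.
  Hence \<open>\<parallel>R f - R g\<parallel>\<close> is small whenever the finitely many cell integrals of \<open>f\<close> and \<open>g\<close>
  nearly agree (\<open>RL_integral_norm_small\<close>); as these numbers are bounded on the unit ball, the
  image of the unit ball is totally bounded. Since \<open>L\<^sub>q\<close> is complete (\<open>mcomplete_Lp\<close>), the
  closure of the image is compact.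

  The remaining pairs \<open>(p, q)\<close> reduce to this case, because on a probability space the unit
  ball of \<open>L\<^sub>p\<close> lies in that of \<open>L\<^sub>r\<close> for \<open>r \<le> p\<close>: take \<open>r = q\<close> if \<open>q < p\<close>, and a large finite
  \<open>r\<close> if \<open>p = q = \<infinity>\<close>.
\<close>

section \<open>Jensen's inequality for powers with weights\<close>

text \<open>The graph of \<open>x powr r\<close> lies above its tangent at \<open>m\<close>.\<close>

lemma powr_tangent_le:
  fixes x m r :: real
  assumes "0 \<le> x" "0 \<le> m" "1 \<le> r"
  shows "r * m powr (r - 1) * x \<le> x powr r + (r - 1) * m powr r"
proof (cases "x = 0 \<or> m = 0")
  case False
  then have pos: "0 < x" "0 < m" using assms by auto
  have "(x powr r) powr (1 / r) * (m powr r) powr (1 - 1 / r)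
      \<le> 1 / r * x powr r + (1 - 1 / r) * m powr r"
    using pos assms by (intro Youngs_inequality_0) auto
  moreover have "(m powr r) powr (1 - 1 / r) = m powr (r - 1)"
    using assms by (simp add: powr_powr right_diff_distrib)
  ultimately have "x * m powr (r - 1) \<le> 1 / r * x powr r + (1 - 1 / r) * m powr r"
    using pos assms by (simp add: powr_powr)
  then have "r * (x * m powr (r - 1)) \<le> r * (1 / r * x powr r + (1 - 1 / r) * m powr r)"
    using assms by (intro mult_left_mono) auto
  then show ?thesis using assms by (simp add: algebra_simps)
qed (use assms in auto)

lemma le_one_plus_powr: "0 \<le> x \<Longrightarrow> 1 \<le> r \<Longrightarrow> x \<le> 1 + x powr r" for x r :: real
  using powr_mono[of 1 r x] by (cases "1 \<le> x") (auto intro: add_increasing2)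

text \<open>Only an upper bound \<open>W\<close> for the total mass of the weight is needed. The integrability of
  \<open>w * F\<close> is a conclusion.\<close>

lemma weighted_jensen_powr:
  fixes w F :: "'a \<Rightarrow> real"
  assumes r: "1 \<le> r" and w: "\<And>x. 0 \<le> w x" and F: "\<And>x. 0 \<le> F x"
    and [measurable]: "F \<in> borel_measurable M"
    and intw: "integrable M w" and intF: "integrable M (\<lambda>x. w x * F x powr r)"
    and W: "(\<integral>x. w x \<partial>M) \<le> W" "0 < W"
  shows "integrable M (\<lambda>x. w x * F x)"
    and "(\<integral>x. w x * F x \<partial>M) powr r \<le> W powr (r - 1) * (\<integral>x. w x * F x powr r \<partial>M)"
proof -
  have [measurable]: "w \<in> borel_measurable M" using intw by auto
  show int1: "integrable M (\<lambda>x. w x * F x)"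
  proof (rule Bochner_Integration.integrable_bound)
    show "integrable M (\<lambda>x. w x + w x * F x powr r)" using intw intF by simp
    have "w x * F x \<le> w x * (1 + F x powr r)" for x
      using le_one_plus_powr[OF F r] w by (intro mult_left_mono) auto
    then show "AE x in M. norm (w x * F x) \<le> norm (w x + w x * F x powr r)"
      using w F by (simp add: distrib_left)
  qed simp
  define I where "I = (\<integral>x. w x * F x \<partial>M)"
  \<comment> \<open>Integrate the tangent inequality at \<open>m\<close>, which is the mean of \<open>F\<close> if \<open>W\<close> is the exact mass.\<close>
  define m where "m = I / W"
  have m: "0 \<le> m" unfolding m_def I_def using w F W by simp
  have I: "I = m * W" using W by (simp add: m_def)
  have "r * m powr (r - 1) * I - (r - 1) * m powr r * (\<integral>x. w x \<partial>M)
      = (\<integral>x. r * m powr (r - 1) * (w x * F x) - (r - 1) * m powr r * w x \<partial>M)"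
    using int1 intw by (simp add: I_def)
  also have "\<dots> \<le> (\<integral>x. w x * F x powr r \<partial>M)"
  proof (rule integral_mono)
    fix x
    have "w x * (r * m powr (r - 1) * F x) \<le> w x * (F x powr r + (r - 1) * m powr r)"
      using powr_tangent_le[OF F m r] w by (intro mult_left_mono) auto
    then show "r * m powr (r - 1) * (w x * F x) - (r - 1) * m powr r * w x \<le> w x * F x powr r"
      by (simp add: algebra_simps)
  qed (use int1 intw intF in auto)
  finally have "r * m powr (r - 1) * I \<le> (\<integral>x. w x * F x powr r \<partial>M) + (r - 1) * m powr r * (\<integral>x. w x \<partial>M)"
    by simp
  also have "\<dots> \<le> (\<integral>x. w x * F x powr r \<partial>M) + (r - 1) * m powr r * W"
    using W r by (intro add_left_mono mult_left_mono) auto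
  also have "r * m powr (r - 1) * I = r * m powr r * W"
    using m by (cases "m = 0") (simp_all add: I powr_diff)
  finally have *: "m powr r * W \<le> (\<integral>x. w x * F x powr r \<partial>M)" by (simp add: algebra_simps)
  have "I powr r = W powr (r - 1) * (m powr r * W)"
    using m W by (simp add: I powr_mult powr_diff)
  also have "\<dots> \<le> W powr (r - 1) * (\<integral>x. w x * F x powr r \<partial>M)"
    using * by (intro mult_left_mono) auto
  finally show "(\<integral>x. w x * F x \<partial>M) powr r \<le> W powr (r - 1) * (\<integral>x. w x * F x powr r \<partial>M)"
    by (simp add: I_def)
qed

section \<open>Norm estimates and limits in Lebesgue spaces\<close>

lemma lp_space_ereal: "f \<in> lp_space M (ereal r) \<longleftrightarrow> f \<in> borel_measurable M \<and> integrable M (\<lambda>x. \<bar>f x\<bar> powr r)"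
  by (simp add: lp_space_def)

lemma lp_norm_ereal: "lp_norm M (ereal r) f = (\<integral>x. \<bar>f x\<bar> powr r \<partial>M) powr (1 / r)"
  by (simp add: lp_norm_def)

lemma lp_norm_ereal_powr: "1 \<le> r \<Longrightarrow> lp_norm M (ereal r) f powr r = (\<integral>x. \<bar>f x\<bar> powr r \<partial>M)"
  by (simp add: lp_norm_ereal powr_powr)

lemma exponent_cases:
  fixes p :: ereal
  assumes "1 \<le> p"
  obtains "p = \<infinity>" | r where "p = ereal r" "1 \<le> r"
  using assms by (cases p) (auto simp: one_ereal_def)

lemma lp_norm_ereal_leI:
  assumes r: "1 \<le> r" and [measurable]: "f \<in> borel_measurable M" and c: "0 \<le> c"
    and le: "(\<integral>\<^sup>+x. ennreal (\<bar>f x\<bar> powr r) \<partial>M) \<le> ennreal (c powr r)"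
  shows "f \<in> lp_space M (ereal r)" and "lp_norm M (ereal r) f \<le> c"
proof -
  have int: "integrable M (\<lambda>x. \<bar>f x\<bar> powr r)"
    using le by (intro integrableI_bounded) (auto simp: top_unique less_top[symmetric])
  then show "f \<in> lp_space M (ereal r)" by (simp add: lp_space_ereal)
  have "(\<integral>x. \<bar>f x\<bar> powr r \<partial>M) \<le> c powr r"
    using le int by (subst (asm) nn_integral_eq_integral) auto
  then have "lp_norm M (ereal r) f \<le> (c powr r) powr (1 / r)"
    unfolding lp_norm_ereal using r by (intro powr_mono2) auto
  then show "lp_norm M (ereal r) f \<le> c" using r c by (simp add: powr_powr)
qed

lemma lp_space_mono:
  assumes p: "1 \<le> p" and g: "g \<in> lp_space M p" and [measurable]: "f \<in> borel_measurable M"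
    and le: "AE x in M. \<bar>f x\<bar> \<le> \<bar>g x\<bar>"
  shows "f \<in> lp_space M p" and "lp_norm M p f \<le> lp_norm M p g"
proof -
  have "f \<in> lp_space M p \<and> lp_norm M p f \<le> lp_norm M p g"
    using p
  proof (cases rule: exponent_cases)
    case 1
    have "AE x in M. \<bar>f x\<bar> \<le> lp_norm M \<infinity> g"
      using le lp_space_PInf_AE[OF g[unfolded 1]] by eventually_elim simp
    then show ?thesis using lp_norm_PInf_leI[OF assms(3)] lp_norm_nonneg[of M \<infinity> g] 1 by simp
  next
    case (2 r)
    have [measurable]: "g \<in> borel_measurable M" and int: "integrable M (\<lambda>x. \<bar>g x\<bar> powr r)"
      using g 2 by (auto simp: lp_space_ereal)
    have "(\<integral>\<^sup>+x. ennreal (\<bar>f x\<bar> powr r) \<partial>M) \<le> (\<integral>\<^sup>+x. ennreal (\<bar>g x\<bar> powr r) \<partial>M)"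
      using le 2 by (intro nn_integral_mono_AE) (auto elim!: AE_mp intro!: powr_mono2 ennreal_leI)
    also have "\<dots> = ennreal (lp_norm M p g powr r)"
      using int 2 by (simp add: nn_integral_eq_integral lp_norm_ereal_powr)
    finally show ?thesis using lp_norm_ereal_leI[OF _ assms(3)] 2 lp_norm_nonneg[of M p g] by simp
  qed
  then show "f \<in> lp_space M p" "lp_norm M p f \<le> lp_norm M p g" by auto
qed

lemma lp_space_cmult:
  assumes p: "1 \<le> p" and f: "f \<in> lp_space M p"
  shows "(\<lambda>x. c * f x) \<in> lp_space M p" and "lp_norm M p (\<lambda>x. c * f x) \<le> \<bar>c\<bar> * lp_norm M p f"
proof -
  note [measurable] = lp_space_measurable[OF f]
  have "(\<lambda>x. c * f x) \<in> lp_space M p \<and> lp_norm M p (\<lambda>x. c * f x) \<le> \<bar>c\<bar> * lp_norm M p f"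
    using p
  proof (cases rule: exponent_cases)
    case 1
    have "AE x in M. \<bar>c * f x\<bar> \<le> \<bar>c\<bar> * lp_norm M \<infinity> f"
      using lp_space_PInf_AE[OF f[unfolded 1]]
      by eventually_elim (simp add: abs_mult mult_left_mono)
    then show ?thesis
      using lp_norm_PInf_leI[of "\<lambda>x. c * f x" M "\<bar>c\<bar> * lp_norm M \<infinity> f"] lp_norm_nonneg[of M \<infinity> f] 1
      by auto
  next
    case (2 r)
    have int: "integrable M (\<lambda>x. \<bar>f x\<bar> powr r)" using f 2 by (auto simp: lp_space_ereal)
    have "(\<integral>\<^sup>+x. ennreal (\<bar>c * f x\<bar> powr r) \<partial>M) = ennreal (\<bar>c\<bar> powr r * (\<integral>x. \<bar>f x\<bar> powr r \<partial>M))"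
      using int by (simp add: abs_mult powr_mult nn_integral_eq_integral)
    also have "\<dots> = ennreal ((\<bar>c\<bar> * lp_norm M p f) powr r)"
      using 2 by (simp add: powr_mult lp_norm_ereal_powr)
    finally show ?thesis
      using lp_norm_ereal_leI[of r "\<lambda>x. c * f x" M "\<bar>c\<bar> * lp_norm M p f"] 2 lp_norm_nonneg[of M p f]
      by auto
  qed
  then show "(\<lambda>x. c * f x) \<in> lp_space M p" "lp_norm M p (\<lambda>x. c * f x) \<le> \<bar>c\<bar> * lp_norm M p f"
    by auto
qed

lemma lp_space_add:
  assumes p: "1 \<le> p" and f: "f \<in> lp_space M p" and g: "g \<in> lp_space M p"
  shows "(\<lambda>x. f x + g x) \<in> lp_space M p"
    and "lp_norm M p (\<lambda>x. f x + g x) \<le> lp_norm M p f + lp_norm M p g"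
  using lp_space_diff[OF p f lp_space_cmult(1)[OF p g, of "-1"]] lp_space_cmult(2)[OF p g, of "-1"]
  by auto

text \<open>Lower semicontinuity of the norm under almost everywhere convergence (Fatou's lemma if
  \<open>p\<close> is finite).\<close>

lemma lp_space_tendsto:
  assumes p: "1 \<le> p" and h: "\<And>i. h i \<in> lp_space M p"
    and [measurable]: "g \<in> borel_measurable M"
    and lim: "AE x in M. (\<lambda>i. h i x) \<longlonglongrightarrow> g x"
    and c: "\<forall>\<^sub>F i in sequentially. lp_norm M p (h i) \<le> c" "0 \<le> c"
  shows "g \<in> lp_space M p" and "lp_norm M p g \<le> c"
proof -
  note [measurable] = lp_space_measurable[OF h]
  have "g \<in> lp_space M p \<and> lp_norm M p g \<le> c"
    using p
  proof (cases rule: exponent_cases)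
    case 1
    have "AE x in M. \<forall>i. \<bar>h i x\<bar> \<le> lp_norm M \<infinity> (h i)"
      using lp_space_PInf_AE h 1 by (auto simp: AE_all_countable)
    then have "AE x in M. \<bar>g x\<bar> \<le> c"
      using lim
    proof eventually_elim
      case (elim x)
      have "\<forall>\<^sub>F i in sequentially. \<bar>h i x\<bar> \<le> c"
        using c(1) by eventually_elim (use elim 1 in \<open>auto intro: order_trans\<close>)
      then show ?case
        using elim(2) by (intro tendsto_upperbound[OF tendsto_rabs]) auto
    qed
    then show ?thesis using lp_norm_PInf_leI[OF assms(3)] c 1 by simp
  next
    case (2 r)
    have "(\<integral>\<^sup>+x. ennreal (\<bar>g x\<bar> powr r) \<partial>M) = (\<integral>\<^sup>+x. liminf (\<lambda>i. ennreal (\<bar>h i x\<bar> powr r)) \<partial>M)"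
    proof (rule nn_integral_cong_AE)
      show "AE x in M. ennreal (\<bar>g x\<bar> powr r) = liminf (\<lambda>i. ennreal (\<bar>h i x\<bar> powr r))"
        using lim
      proof eventually_elim
        case (elim x)
        have "(\<lambda>i. \<bar>h i x\<bar> powr r) \<longlonglongrightarrow> \<bar>g x\<bar> powr r"
          using elim 2 by (intro tendsto_powr' tendsto_rabs tendsto_const) auto
        then have "(\<lambda>i. ennreal (\<bar>h i x\<bar> powr r)) \<longlonglongrightarrow> ennreal (\<bar>g x\<bar> powr r)"
          by (rule tendsto_ennrealI)
        then show ?case by (intro lim_imp_Liminf[symmetric]) auto
      qed
    qed
    also have "\<dots> \<le> liminf (\<lambda>i. \<integral>\<^sup>+x. ennreal (\<bar>h i x\<bar> powr r) \<partial>M)"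
      by (intro nn_integral_liminf) auto
    also have "\<dots> \<le> ennreal (c powr r)"
    proof (rule Liminf_le)
      show "\<forall>\<^sub>F i in sequentially. (\<integral>\<^sup>+x. ennreal (\<bar>h i x\<bar> powr r) \<partial>M) \<le> ennreal (c powr r)"
        using c(1)
      proof eventually_elim
        case (elim i)
        have "(\<integral>\<^sup>+x. ennreal (\<bar>h i x\<bar> powr r) \<partial>M) = ennreal (lp_norm M p (h i) powr r)"
          using h[of i] 2 by (simp add: lp_space_ereal nn_integral_eq_integral lp_norm_ereal_powr)
        then show ?case
          using elim 2 lp_norm_nonneg[of M p "h i"] by (auto intro!: ennreal_leI powr_mono2)
      qed
    qed auto
    finally show ?thesis using lp_norm_ereal_leI[of r g M c] c 2 by auto
  qed
  then show "g \<in> lp_space M p" "lp_norm M p g \<le> c" by auto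
qed

section \<open>Inclusions and completeness over a probability space\<close>

context prob_space
begin

lemma lp_space_const:
  assumes "1 \<le> p"
  shows "(\<lambda>x. c) \<in> lp_space M p" and "lp_norm M p (\<lambda>x. c) \<le> \<bar>c\<bar>"
proof -
  have "(\<lambda>x. c) \<in> lp_space M p \<and> lp_norm M p (\<lambda>x. c) \<le> \<bar>c\<bar>"
    using assms
  proof (cases rule: exponent_cases)
    case 1
    then show ?thesis using lp_norm_PInf_leI[of "\<lambda>x. c" M "\<bar>c\<bar>"] by auto
  next
    case (2 r)
    then show ?thesis using lp_norm_ereal_leI[of r "\<lambda>x. c" M "\<bar>c\<bar>"] by (simp add: emeasure_space_1)
  qed
  then show "(\<lambda>x. c) \<in> lp_space M p" "lp_norm M p (\<lambda>x. c) \<le> \<bar>c\<bar>" by auto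
qed

lemma lp_space_antimono:
  assumes pp: "1 \<le> p'" "p' \<le> p" and f: "f \<in> lp_space M p"
  shows "f \<in> lp_space M p'" and "lp_norm M p' f \<le> lp_norm M p f"
proof -
  note [measurable] = lp_space_measurable[OF f]
  have "f \<in> lp_space M p' \<and> lp_norm M p' f \<le> lp_norm M p f"
  proof (cases "p = \<infinity>")
    case True
    have "AE x in M. \<bar>f x\<bar> \<le> \<bar>lp_norm M \<infinity> f\<bar>"
      using lp_space_PInf_AE[OF f[unfolded True]] by eventually_elim simp
    then show ?thesis
      using lp_space_mono[OF pp(1) lp_space_const(1)[OF pp(1)]] lp_space_const(2)[OF pp(1)] True
        lp_norm_nonneg[of M \<infinity> f] lp_space_measurable[OF f] by (metis abs_of_nonneg order_trans)
  next
    case False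
    have "1 \<le> p" using pp by simp
    then obtain r where r: "p = ereal r" "1 \<le> r" using False by (cases rule: exponent_cases) auto
    from pp(1) obtain r' where r': "p' = ereal r'" "1 \<le> r'"
      using pp(2) r by (cases rule: exponent_cases) auto
    have le: "r' \<le> r" using pp r r' by simp
    have int: "integrable M (\<lambda>x. \<bar>f x\<bar> powr r)" using f r by (auto simp: lp_space_ereal)
    have J: "integrable M (\<lambda>x. \<bar>f x\<bar> powr r')"
      "(\<integral>x. \<bar>f x\<bar> powr r' \<partial>M) powr (r / r') \<le> (\<integral>x. \<bar>f x\<bar> powr r \<partial>M)"
      using weighted_jensen_powr[of "r / r'" "\<lambda>_. 1" "\<lambda>x. \<bar>f x\<bar> powr r'" M 1] int r r' le
      by (simp_all add: powr_powr prob_space)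
    have "lp_norm M p' f = ((\<integral>x. \<bar>f x\<bar> powr r' \<partial>M) powr (r / r')) powr (1 / r)"
      using r r' by (simp add: lp_norm_ereal powr_powr)
    also have "\<dots> \<le> lp_norm M p f"
      unfolding lp_norm_ereal r using J(2) r r' by (intro powr_mono2) (auto simp: powr_powr)
    finally show ?thesis using J(1) r' by (simp add: lp_space_ereal)
  qed
  then show "f \<in> lp_space M p'" "lp_norm M p' f \<le> lp_norm M p f" by auto
qed

lemma lp_space_integrable:
  assumes "1 \<le> p" "f \<in> lp_space M p"
  shows "integrable M f" and "(\<integral>x. \<bar>f x\<bar> \<partial>M) \<le> lp_norm M p f"
proof -
  have *: "f \<in> lp_space M (ereal 1)" "lp_norm M (ereal 1) f \<le> lp_norm M p f"
    using lp_space_antimono[of "ereal 1" p f] assms by (auto simp: one_ereal_def)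
  then have "integrable M (\<lambda>x. \<bar>f x\<bar>)" and [measurable]: "f \<in> borel_measurable M"
    by (auto simp: lp_space_ereal)
  then show "integrable M f" using integrable_abs_cancel by blast
  show "(\<integral>x. \<bar>f x\<bar> \<partial>M) \<le> lp_norm M p f" using * by (simp add: lp_norm_ereal)
qed

text \<open>A Cauchy sequence in \<open>L\<^sub>p\<close> is Cauchy in \<open>L\<^sub>1\<close>, so a subsequence converges almost
  everywhere, and lower semicontinuity of the norm turns this into convergence in \<open>L\<^sub>p\<close>. This
  treats \<open>p = \<infinity>\<close> and finite \<open>p\<close> at once.\<close>

lemma mcomplete_Lp:
  assumes p: "1 \<le> p"
  shows "Metric_space.mcomplete (Lp M p) (Lp_dist M p)"
proof -
  interpret X: Metric_space "Lp M p" "Lp_dist M p" by (rule Metric_space_Lp[OF p])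
  show ?thesis
    unfolding X.mcomplete_def
  proof (intro allI impI)
    fix \<sigma> assume Cau: "X.MCauchy \<sigma>"
    have "\<exists>f. f \<in> lp_space M p \<and> \<sigma> n = Lp_class M p f" for n
    proof -
      have "\<sigma> n \<in> Lp M p" using Cau by (auto simp: X.MCauchy_def)
      then show ?thesis by (auto simp: Lp_def Lp_class_def elim: quotientE)
    qed
    then obtain f where f: "\<And>n. f n \<in> lp_space M p" and \<sigma>: "\<And>n. \<sigma> n = Lp_class M p (f n)"
      by metis
    note [measurable] = lp_space_measurable[OF f]
    have diff: "(\<lambda>x. f i x - f j x) \<in> lp_space M p" for i j
      by (intro lp_space_diff p f)
    have N: "\<exists>N. \<forall>i\<ge>N. \<forall>j\<ge>N. lp_norm M p (\<lambda>x. f i x - f j x) < e" if "0 < e" for e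
    proof -
      have "\<exists>N. \<forall>i j. N \<le> i \<longrightarrow> N \<le> j \<longrightarrow> Lp_dist M p (\<sigma> i) (\<sigma> j) < e"
        using Cau that unfolding X.MCauchy_def by blast
      then show ?thesis unfolding \<sigma> Lp_dist_class[OF p f f] by blast
    qed
    obtain r where r: "strict_mono r" "AE x in M. Cauchy (\<lambda>i. f (r i) x)"
    proof (rule cauchy_L1_AE_cauchy_subseq)
      show "integrable M (f n)" for n by (rule lp_space_integrable[OF p f])
      show "\<exists>N. \<forall>i\<ge>N. \<forall>j\<ge>N. LINT x|M. norm (f i x - f j x) < e" if "0 < e" for e
        unfolding real_norm_def
        using N[OF that] order_le_less_trans[OF lp_space_integrable(2)[OF p diff]] by blast
    qed
    define g where "g x = lim (\<lambda>i. f (r i) x)" for x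
    have [measurable]: "g \<in> borel_measurable M"
      unfolding g_def by (intro borel_measurable_lim_metric) simp
    have lim: "AE x in M. (\<lambda>i. f (r i) x) \<longlonglongrightarrow> g x"
      using r(2) by eventually_elim (simp add: g_def Cauchy_convergent_iff convergent_LIMSEQ_iff)
    have close: "(\<lambda>x. f n x - g x) \<in> lp_space M p \<and> lp_norm M p (\<lambda>x. f n x - g x) \<le> e"
      if e: "0 < e" and n: "n \<ge> N" and N: "\<forall>i\<ge>N. \<forall>j\<ge>N. lp_norm M p (\<lambda>x. f i x - f j x) < e" for e n N
    proof -
      have "AE x in M. (\<lambda>i. f n x - f (r i) x) \<longlonglongrightarrow> f n x - g x"
        using lim by eventually_elim (intro tendsto_intros)
      moreover have "\<forall>\<^sub>F i in sequentially. lp_norm M p (\<lambda>x. f n x - f (r i) x) \<le> e"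
        using eventually_ge_at_top[of N]
      proof eventually_elim
        case (elim i)
        then have "N \<le> r i" using seq_suble[OF r(1)] order_trans by blast
        then show ?case using N n by (intro less_imp_le) auto
      qed
      ultimately show ?thesis
        using lp_space_tendsto[of p "\<lambda>i x. f n x - f (r i) x" M "\<lambda>x. f n x - g x" e] p diff e
        by simp
    qed
    have g: "g \<in> lp_space M p"
    proof -
      obtain N where "\<forall>i\<ge>N. \<forall>j\<ge>N. lp_norm M p (\<lambda>x. f i x - f j x) < 1" using N[of 1] by auto
      then have "(\<lambda>x. f N x - g x) \<in> lp_space M p" using close[of 1 N N] by auto
      from lp_space_diff(1)[OF p f[of N] this] show ?thesis by simp
    qed
    have "limitin X.mtopology \<sigma> (Lp_class M p g) sequentially"
      unfolding X.limit_metric_sequentially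
    proof (intro conjI allI impI)
      show "Lp_class M p g \<in> Lp M p" using g by (rule Lp_class_in_Lp)
      fix e :: real assume "0 < e"
      then obtain N where N: "\<forall>i\<ge>N. \<forall>j\<ge>N. lp_norm M p (\<lambda>x. f i x - f j x) < e / 2" using N[of "e/2"] by auto
      show "\<exists>N. \<forall>n\<ge>N. \<sigma> n \<in> Lp M p \<and> Lp_dist M p (\<sigma> n) (Lp_class M p g) < e"
      proof (intro exI allI impI)
        fix n assume "N \<le> n"
        then have "lp_norm M p (\<lambda>x. f n x - g x) \<le> e / 2" using close[of "e/2" N n] N \<open>0 < e\<close> by auto
        then show "\<sigma> n \<in> Lp M p \<and> Lp_dist M p (\<sigma> n) (Lp_class M p g) < e"
          using \<open>0 < e\<close> by (simp add: \<sigma> Lp_dist_class[OF p f g] Lp_class_in_Lp[OF f])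
      qed
    qed
    then show "\<exists>x. limitin X.mtopology \<sigma> x sequentially" ..
  qed
qed

end

section \<open>Convolution with truncated powers on the unit interval\<close>

abbreviation I01 :: "real measure" where "I01 \<equiv> lebesgue_on {0..1}"

interpretation I01: prob_space I01
  by (rule prob_spaceI) (simp add: emeasure_restrict_space)

interpretation I01_pair: pair_sigma_finite I01 I01 ..

lemma I01_ident_measurable [measurable]: "(\<lambda>x. x) \<in> borel_measurable I01"
  using id_borel_measurable_lebesgue_on by (simp add: id_def)

lemma I01_pair_measurable [measurable]:
  "fst \<in> borel_measurable (I01 \<Otimes>\<^sub>M I01)" "snd \<in> borel_measurable (I01 \<Otimes>\<^sub>M I01)"
  using measurable_compose[OF measurable_fst I01_ident_measurable]
    measurable_compose[OF measurable_snd I01_ident_measurable] by simp_all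

text \<open>The truncated power, \<open>u powr c\<close> for \<open>u > 0\<close> and \<open>0\<close> for \<open>u \<le> 0\<close>. Inserting \<open>u = t - s\<close> restricts
  integrals in \<open>s\<close> over the unit interval to \<open>s < t\<close>.\<close>

definition tpow :: "real \<Rightarrow> real \<Rightarrow> real" where
  "tpow c u = (if 0 < u then u powr c else 0)"

lemma tpow_nonneg [simp]: "0 \<le> tpow c u"
  by (simp add: tpow_def)

lemma tpow_mult: "tpow c u * tpow d u = tpow (c + d) u"
  by (simp add: tpow_def powr_add)

lemma tpow_powr: "tpow c u powr r = tpow (c * r) u"
  by (simp add: tpow_def powr_powr)

lemma tpow_measurable [measurable (raw)]:
  assumes [measurable]: "f \<in> borel_measurable M" "g \<in> borel_measurable M"
  shows "(\<lambda>x. tpow (f x) (g x)) \<in> borel_measurable M"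
  unfolding tpow_def by measurable

lemma nn_integral_I01: "integral\<^sup>N I01 f = (\<integral>\<^sup>+x. f x * indicator {0..1} x \<partial>lborel)"
  by (simp add: nn_integral_restrict_space nn_integral_completion)

lemma nn_integral_powr_unit:
  assumes "-1 < c"
  shows "(\<integral>\<^sup>+u. ennreal (u powr c) * indicator {0..1} u \<partial>lborel) = ennreal (1 / (c + 1))"
  using nn_integral_has_integral_lebesgue'[OF _ has_integral_powr_from_0[OF assms, of 1]] by simp

lemma nn_integral_tpow_le:
  assumes c: "-1 < c" and x: "x \<in> {0..1}"
  shows "(\<integral>\<^sup>+t. ennreal (tpow c (t - x)) \<partial>I01) \<le> ennreal (1 / (c + 1))"
    and "(\<integral>\<^sup>+s. ennreal (tpow c (x - s)) \<partial>I01) \<le> ennreal (1 / (c + 1))"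
proof -
  let ?g = "\<lambda>u. ennreal (u powr c) * indicator {0..1::real} u"
  have "(\<integral>\<^sup>+t. ennreal (tpow c (t - x)) \<partial>I01) \<le> (\<integral>\<^sup>+y. ?g (y - x) \<partial>lborel)"
    unfolding nn_integral_I01 using x
    by (intro nn_integral_mono) (auto simp: tpow_def indicator_def)
  also have "\<dots> = (\<integral>\<^sup>+u. ?g u \<partial>lborel)"
    using nn_integral_real_affine[of "\<lambda>y. ?g (y - x)" 1 x] by simp
  finally show "(\<integral>\<^sup>+t. ennreal (tpow c (t - x)) \<partial>I01) \<le> ennreal (1 / (c + 1))"
    by (simp add: nn_integral_powr_unit[OF c])
  have "(\<integral>\<^sup>+s. ennreal (tpow c (x - s)) \<partial>I01) \<le> (\<integral>\<^sup>+y. ?g (x - y) \<partial>lborel)"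
    unfolding nn_integral_I01 using x
    by (intro nn_integral_mono) (auto simp: tpow_def indicator_def)
  also have "\<dots> = (\<integral>\<^sup>+u. ?g u \<partial>lborel)"
    using nn_integral_real_affine[of "\<lambda>y. ?g (x - y)" "-1" x] by simp
  finally show "(\<integral>\<^sup>+s. ennreal (tpow c (x - s)) \<partial>I01) \<le> ennreal (1 / (c + 1))"
    by (simp add: nn_integral_powr_unit[OF c])
qed

lemma tpow_integrable:
  assumes c: "-1 < c" and t: "t \<in> {0..1}"
  shows "integrable I01 (\<lambda>s. tpow c (t - s))"
    and "(\<integral>s. tpow c (t - s) \<partial>I01) \<le> 1 / (c + 1)"
proof -
  note le = nn_integral_tpow_le(2)[OF c t]
  show int: "integrable I01 (\<lambda>s. tpow c (t - s))"
    using le by (intro integrableI_bounded) (auto simp: top_unique less_top[symmetric])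
  show "(\<integral>s. tpow c (t - s) \<partial>I01) \<le> 1 / (c + 1)"
    using le c by (simp add: nn_integral_eq_integral[OF int])
qed

text \<open>Tonelli's theorem: convolution with \<open>tpow c\<close> is bounded on \<open>L\<^sub>1\<close>.\<close>

lemma tpow_convolution:
  assumes c: "-1 < c" and G: "integrable I01 G" and pos: "\<And>s. 0 \<le> G s"
  shows "AE t in I01. integrable I01 (\<lambda>s. tpow c (t - s) * G s)"
    and "(\<integral>\<^sup>+t. ennreal (\<integral>s. tpow c (t - s) * G s \<partial>I01) \<partial>I01) \<le> ennreal (1 / (c + 1) * (\<integral>s. G s \<partial>I01))"
proof -
  have [measurable]: "G \<in> borel_measurable I01" using G by auto
  let ?I = "\<lambda>t. \<integral>\<^sup>+s. ennreal (tpow c (t - s) * G s) \<partial>I01"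
  have "(\<integral>\<^sup>+t. ?I t \<partial>I01) = (\<integral>\<^sup>+s. (\<integral>\<^sup>+t. ennreal (tpow c (t - s) * G s) \<partial>I01) \<partial>I01)"
    by (rule I01_pair.Fubini'[symmetric]) measurable
  also have "\<dots> = (\<integral>\<^sup>+s. (\<integral>\<^sup>+t. ennreal (tpow c (t - s)) \<partial>I01) * ennreal (G s) \<partial>I01)"
    by (intro nn_integral_cong) (simp add: ennreal_mult pos nn_integral_multc)
  also have "\<dots> \<le> (\<integral>\<^sup>+s. ennreal (1 / (c + 1)) * ennreal (G s) \<partial>I01)"
    using c by (intro nn_integral_mono mult_right_mono nn_integral_tpow_le) (auto simp: space_restrict_space)
  also have "\<dots> = ennreal (1 / (c + 1) * (\<integral>s. G s \<partial>I01))"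
    using c pos by (subst nn_integral_cmult) (auto simp: nn_integral_eq_integral[OF G] ennreal_mult'[symmetric])
  finally have le: "(\<integral>\<^sup>+t. ?I t \<partial>I01) \<le> ennreal (1 / (c + 1) * (\<integral>s. G s \<partial>I01))" .
  then have "(\<integral>\<^sup>+t. ?I t \<partial>I01) \<noteq> \<infinity>" by (auto simp: top_unique)
  then have fin: "AE t in I01. ?I t \<noteq> \<infinity>" by (intro nn_integral_noteq_infinite) auto
  then show ae: "AE t in I01. integrable I01 (\<lambda>s. tpow c (t - s) * G s)"
    by eventually_elim (auto intro!: integrableI_bounded simp: pos less_top[symmetric] abs_mult)
  have "(\<integral>\<^sup>+t. ennreal (\<integral>s. tpow c (t - s) * G s \<partial>I01) \<partial>I01) = (\<integral>\<^sup>+t. ?I t \<partial>I01)"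
    using ae by (intro nn_integral_cong_AE, eventually_elim) (simp add: nn_integral_eq_integral pos)
  with le show "(\<integral>\<^sup>+t. ennreal (\<integral>s. tpow c (t - s) * G s \<partial>I01) \<partial>I01) \<le> ennreal (1 / (c + 1) * (\<integral>s. G s \<partial>I01))"
    by simp
qed

section \<open>The Riemann--Liouville potential of constant order\<close>

text \<open>The Riemann--Liouville integral of \<open>\<bar>h\<bar>\<close> of constant order \<open>a\<close>, without the factor
  \<open>1 / Gamma a\<close>. Its value is \<open>0\<close> at points where the integral diverges.\<close>

definition RL_potential :: "real \<Rightarrow> (real \<Rightarrow> real) \<Rightarrow> real \<Rightarrow> real" where
  "RL_potential a h t = (\<integral>s. tpow (a - 1) (t - s) * \<bar>h s\<bar> \<partial>I01)"

lemma RL_potential_nonneg: "0 \<le> RL_potential a h t"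
  by (simp add: RL_potential_def)

lemma RL_potential_measurable [measurable]:
  assumes [measurable]: "h \<in> borel_measurable I01"
  shows "RL_potential a h \<in> borel_measurable I01"
  unfolding RL_potential_def by measurable

text \<open>Jensen's inequality with weight \<open>(t - s) powr (\<kappa> - 1)\<close>, whose mass is at most \<open>1 / \<kappa>\<close>, applied
  to \<open>(t - s) powr (a - \<kappa>) * \<bar>h s\<bar>\<close>.\<close>

lemma RL_potential_powr_le:
  assumes p: "1 \<le> p" and \<kappa>: "0 < \<kappa>" and t: "t \<in> {0..1}"
    and [measurable]: "h \<in> borel_measurable I01"
    and int: "integrable I01 (\<lambda>s. tpow (\<kappa> - 1 + (a - \<kappa>) * p) (t - s) * \<bar>h s\<bar> powr p)"
  shows "RL_potential a h t powr p
    \<le> (1 / \<kappa>) powr (p - 1) * (\<integral>s. tpow (\<kappa> - 1 + (a - \<kappa>) * p) (t - s) * \<bar>h s\<bar> powr p \<partial>I01)"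
proof -
  have e1: "tpow (\<kappa> - 1) u * (tpow (a - \<kappa>) u * y) = tpow (a - 1) u * y" for u y
    by (simp add: mult.assoc[symmetric] tpow_mult)
  have e2: "tpow (\<kappa> - 1) u * (tpow (a - \<kappa>) u * y) powr p = tpow (\<kappa> - 1 + (a - \<kappa>) * p) u * y powr p" for u y
    by (simp add: mult.assoc[symmetric] tpow_mult powr_mult tpow_powr)
  show ?thesis
    using weighted_jensen_powr(2)[of p "\<lambda>s. tpow (\<kappa> - 1) (t - s)"
        "\<lambda>s. tpow (a - \<kappa>) (t - s) * \<bar>h s\<bar>" I01 "1 / \<kappa>"]
      tpow_integrable[of "\<kappa> - 1" t] p \<kappa> t int
    by (simp add: e1 e2 RL_potential_def)
qed

text \<open>After the first Jensen step the power of \<open>t - s\<close> next to \<open>\<bar>h\<bar> powr p\<close> is \<open>b * p\<close>; the second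
  step, with weight \<open>\<bar>h\<bar> powr p\<close> and exponent \<open>q / p\<close>, makes it \<open>b * q\<close>. The choice of \<open>\<kappa>\<close> gives
  \<open>b * q = \<kappa> * q / p - 1 > - 1\<close>, so this power is integrable.\<close>

lemma RL_potential_bounded_finite:
  assumes p: "1 \<le> p" and pq: "p \<le> q" and a: "1 / p - 1 / q < a" and R: "0 < R"
  shows "\<exists>C\<ge>0. \<forall>h\<in>lp_space I01 (ereal p). lp_norm I01 (ereal p) h \<le> R \<longrightarrow>
    RL_potential a h \<in> lp_space I01 (ereal q) \<and> lp_norm I01 (ereal q) (RL_potential a h) \<le> C"
proof -
  define \<kappa> where "\<kappa> = a - (1 / p - 1 / q)"
  define b where "b = \<kappa> / p - 1 / q"
  have \<kappa>: "0 < \<kappa>" using a by (simp add: \<kappa>_def)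
  have q: "1 \<le> q" using p pq by simp
  have bp: "\<kappa> - 1 + (a - \<kappa>) * p = b * p"
    using p by (simp add: b_def \<kappa>_def field_simps)
  have bq: "-1 < b * q" using p q \<kappa> by (simp add: b_def field_simps)
  define A where "A = ((1 / \<kappa>) powr (p - 1)) powr (q / p) * (R powr p) powr (q / p - 1)"
  define C where "C = (A * (1 / (b * q + 1) * R powr p)) powr (1 / q)"
  have A: "0 \<le> A" by (simp add: A_def)
  show ?thesis
  proof (intro exI[of _ C] conjI ballI impI)
    show "0 \<le> C" by (simp add: C_def)
    fix h assume h: "h \<in> lp_space I01 (ereal p)" and hR: "lp_norm I01 (ereal p) h \<le> R"
    have [measurable]: "h \<in> borel_measurable I01" and int: "integrable I01 (\<lambda>s. \<bar>h s\<bar> powr p)"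
      using h by (auto simp: lp_space_ereal)
    have hR': "(\<integral>s. \<bar>h s\<bar> powr p \<partial>I01) \<le> R powr p"
      using hR p lp_norm_nonneg[of I01 "ereal p" h]
      by (simp add: lp_norm_ereal_powr[symmetric] powr_mono2)
    have "(\<integral>\<^sup>+t. ennreal (\<bar>RL_potential a h t\<bar> powr q) \<partial>I01)
        \<le> (\<integral>\<^sup>+t. ennreal A * ennreal (\<integral>s. tpow (b * q) (t - s) * \<bar>h s\<bar> powr p \<partial>I01) \<partial>I01)"
    proof (rule nn_integral_mono_AE)
      show "AE t in I01. ennreal (\<bar>RL_potential a h t\<bar> powr q)
          \<le> ennreal A * ennreal (\<integral>s. tpow (b * q) (t - s) * \<bar>h s\<bar> powr p \<partial>I01)"
        using tpow_convolution(1)[OF bq int powr_ge_zero] AE_space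
      proof eventually_elim
        case (elim t)
        then have t: "t \<in> {0..1}" by (simp add: space_restrict_space)
        have qp: "tpow (b * p) u powr (q / p) = tpow (b * q) u" for u
          using p by (simp add: tpow_powr)
        have J: "integrable I01 (\<lambda>s. \<bar>h s\<bar> powr p * tpow (b * p) (t - s))"
          "(\<integral>s. \<bar>h s\<bar> powr p * tpow (b * p) (t - s) \<partial>I01) powr (q / p)
            \<le> (R powr p) powr (q / p - 1) * (\<integral>s. \<bar>h s\<bar> powr p * tpow (b * q) (t - s) \<partial>I01)"
          using weighted_jensen_powr[of "q / p" "\<lambda>s. \<bar>h s\<bar> powr p" "\<lambda>s. tpow (b * p) (t - s)" I01 "R powr p"]
            p pq int elim hR' R by (simp_all add: qp mult.commute)
        have "RL_potential a h t powr q = (RL_potential a h t powr p) powr (q / p)"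
          using p by (simp add: powr_powr)
        also have "\<dots> \<le> ((1 / \<kappa>) powr (p - 1) * (\<integral>s. tpow (b * p) (t - s) * \<bar>h s\<bar> powr p \<partial>I01)) powr (q / p)"
          using RL_potential_powr_le[OF p \<kappa> t, of h a, unfolded bp] J(1) p q
          by (intro powr_mono2) (simp_all add: mult.commute RL_potential_nonneg)
        also have "\<dots> = ((1 / \<kappa>) powr (p - 1)) powr (q / p)
            * (\<integral>s. \<bar>h s\<bar> powr p * tpow (b * p) (t - s) \<partial>I01) powr (q / p)"
          by (simp add: powr_mult mult.commute)
        also have "\<dots> \<le> A * (\<integral>s. \<bar>h s\<bar> powr p * tpow (b * q) (t - s) \<partial>I01)"
          unfolding A_def mult.assoc by (intro mult_left_mono J) simp
        finally show ?case
          using A by (simp add: RL_potential_nonneg ennreal_mult'[symmetric] mult.commute ennreal_leI)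
      qed
    qed
    also have "\<dots> = ennreal A * (\<integral>\<^sup>+t. ennreal (\<integral>s. tpow (b * q) (t - s) * \<bar>h s\<bar> powr p \<partial>I01) \<partial>I01)"
      by (intro nn_integral_cmult) measurable
    also have "\<dots> \<le> ennreal A * ennreal (1 / (b * q + 1) * (\<integral>s. \<bar>h s\<bar> powr p \<partial>I01))"
      by (intro mult_left_mono tpow_convolution(2)[OF bq int powr_ge_zero]) simp
    also have "\<dots> = ennreal (A * (1 / (b * q + 1) * (\<integral>s. \<bar>h s\<bar> powr p \<partial>I01)))"
      using A by (simp add: ennreal_mult'[symmetric])
    also have "\<dots> \<le> ennreal (A * (1 / (b * q + 1) * R powr p))"
      using A bq hR' by (intro ennreal_leI mult_left_mono) auto
    also have "A * (1 / (b * q + 1) * R powr p) = C powr q"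
      using A bq q by (simp add: C_def powr_powr)
    finally have le: "(\<integral>\<^sup>+t. ennreal (\<bar>RL_potential a h t\<bar> powr q) \<partial>I01) \<le> ennreal (C powr q)" .
    show "RL_potential a h \<in> lp_space I01 (ereal q)" "lp_norm I01 (ereal q) (RL_potential a h) \<le> C"
      by (rule lp_norm_ereal_leI[OF q _ _ le]; simp add: C_def)+
  qed
qed

text \<open>For \<open>q = \<infinity>\<close> the power that remains after the first Jensen step is \<open>\<kappa> > 0\<close>, hence bounded
  by \<open>1\<close>, and no second step is needed.\<close>

lemma RL_potential_bounded_PInf:
  assumes p: "1 \<le> p" and a: "1 / p < a" and R: "0 < R"
  shows "\<exists>C\<ge>0. \<forall>h\<in>lp_space I01 (ereal p). lp_norm I01 (ereal p) h \<le> R \<longrightarrow>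
    RL_potential a h \<in> lp_space I01 \<infinity> \<and> lp_norm I01 \<infinity> (RL_potential a h) \<le> C"
proof -
  define \<kappa> where "\<kappa> = a - 1 / p"
  have \<kappa>: "0 < \<kappa>" using a by (simp add: \<kappa>_def)
  have bp: "\<kappa> - 1 + (a - \<kappa>) * p = \<kappa>"
    using p by (simp add: \<kappa>_def field_simps)
  define C where "C = ((1 / \<kappa>) powr (p - 1) * R powr p) powr (1 / p)"
  show ?thesis
  proof (intro exI[of _ C] conjI ballI impI)
    show "0 \<le> C" by (simp add: C_def)
    fix h assume h: "h \<in> lp_space I01 (ereal p)" and hR: "lp_norm I01 (ereal p) h \<le> R"
    have [measurable]: "h \<in> borel_measurable I01" and int: "integrable I01 (\<lambda>s. \<bar>h s\<bar> powr p)"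
      using h by (auto simp: lp_space_ereal)
    have hR': "(\<integral>s. \<bar>h s\<bar> powr p \<partial>I01) \<le> R powr p"
      using hR p lp_norm_nonneg[of I01 "ereal p" h]
      by (simp add: lp_norm_ereal_powr[symmetric] powr_mono2)
    have le: "RL_potential a h t \<le> C" if t: "t \<in> {0..1}" for t
    proof -
      have dom: "tpow \<kappa> (t - s) * \<bar>h s\<bar> powr p \<le> \<bar>h s\<bar> powr p" if "s \<in> {0..1}" for s
        using t that \<kappa> powr_le1[of \<kappa> "t - s"] by (auto simp: tpow_def intro!: mult_left_le_one_le)
      have int': "integrable I01 (\<lambda>s. tpow \<kappa> (t - s) * \<bar>h s\<bar> powr p)"
        using dom by (intro Bochner_Integration.integrable_bound[OF int])
          (auto simp: space_restrict_space abs_mult intro!: AE_I2)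
      have "RL_potential a h t powr p \<le> (1 / \<kappa>) powr (p - 1) * (\<integral>s. tpow \<kappa> (t - s) * \<bar>h s\<bar> powr p \<partial>I01)"
        using RL_potential_powr_le[OF p \<kappa> t, of h a] int' by (simp add: bp)
      also have "\<dots> \<le> (1 / \<kappa>) powr (p - 1) * (\<integral>s. \<bar>h s\<bar> powr p \<partial>I01)"
        using dom int int' by (intro mult_left_mono integral_mono) (auto simp: space_restrict_space)
      also have "\<dots> \<le> (1 / \<kappa>) powr (p - 1) * R powr p"
        by (intro mult_left_mono hR') simp
      finally have "(RL_potential a h t powr p) powr (1 / p) \<le> C"
        unfolding C_def using p by (intro powr_mono2) auto
      then show ?thesis using p RL_potential_nonneg[of a h t] by (simp add: powr_powr)
    qed
    have "AE t in I01. \<bar>RL_potential a h t\<bar> \<le> C"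
      using le by (intro AE_I2) (auto simp: RL_potential_nonneg space_restrict_space)
    then show "RL_potential a h \<in> lp_space I01 \<infinity>" "lp_norm I01 \<infinity> (RL_potential a h) \<le> C"
      using lp_norm_PInf_leI[of "RL_potential a h" I01 C] by (simp_all add: C_def)
  qed
qed

lemma RL_potential_bounded:
  assumes p: "1 \<le> p" and pq: "ereal p \<le> q" and a: "1 / ereal p - 1 / q < ereal a" and R: "0 < R"
  shows "\<exists>C\<ge>0. \<forall>h\<in>lp_space I01 (ereal p). lp_norm I01 (ereal p) h \<le> R \<longrightarrow>
    RL_potential a h \<in> lp_space I01 q \<and> lp_norm I01 q (RL_potential a h) \<le> C"
proof (cases q)
  case (real r)
  then show ?thesis using RL_potential_bounded_finite[of p r a R] assms by (simp add: one_ereal_def)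
next
  case PInf
  then show ?thesis using RL_potential_bounded_PInf[of p a R] assms by (simp add: one_ereal_def)
qed (use pq in simp)

section \<open>The kernel of variable order and its regularisation\<close>

text \<open>The bound on \<open>\<bar>x - 1\<bar> * rGamma x\<close> makes the Lipschitz constants below independent of the
  order: for \<open>x > 1\<close> it is the bound on \<open>rGamma\<close> at \<open>x - 1\<close>.\<close>

lemma rGamma_bounded:
  "\<exists>B>0. \<forall>x::real. 0 < x \<longrightarrow> 0 \<le> rGamma x \<and> rGamma x \<le> B \<and> \<bar>x - 1\<bar> * rGamma x \<le> B"
proof -
  have "compact (rGamma ` {0..2::real})"
    by (intro compact_continuous_image continuous_on_rGamma compact_Icc)
  then obtain B0 where B0: "\<And>x::real. x \<in> {0..2} \<Longrightarrow> \<bar>rGamma x\<bar> \<le> B0"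
    by (metis compact_imp_bounded bounded_iff image_eqI real_norm_def)
  define B where "B = max 1 B0"
  have pos: "0 \<le> rGamma x" if "0 < x" for x :: real
    using that by (simp add: rGamma_inverse_Gamma Gamma_real_nonneg)
  have le: "rGamma x \<le> B" if "0 < x" for x :: real
  proof (cases "x \<le> 2")
    case True
    then show ?thesis using B0[of x] that by (simp add: B_def)
  next
    case False
    then have "Gamma 2 < Gamma x" by (intro Gamma_real_strict_mono) auto
    then have "1 \<le> Gamma x" using Gamma_fact[of 1, where 'a=real] by simp
    then show ?thesis by (simp add: rGamma_inverse_Gamma B_def inverse_le_1_iff max.coboundedI1)
  qed
  have "\<bar>x - 1\<bar> * rGamma x \<le> B" if "0 < x" for x :: real
  proof (cases "x \<le> 1")
    case True
    have "\<bar>x - 1\<bar> * rGamma x \<le> 1 * rGamma x"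
      using that True pos[OF that] by (intro mult_right_mono) auto
    then show ?thesis using le[OF that] by simp
  next
    case False
    then show ?thesis using rGamma_plus1[of "x - 1"] le[of "x - 1"] by simp
  qed
  moreover have "0 < B" by (simp add: B_def)
  ultimately show ?thesis using pos le by blast
qed

text \<open>The kernel of order \<open>a\<close> as a function of \<open>u = t - s\<close>. The factor
  \<open>rGamma a\<close> is \<open>1 / Gamma a\<close>; as it is continuous on the whole line, it is measurable in \<open>a\<close>.\<close>

definition RL_kernel :: "real \<Rightarrow> real \<Rightarrow> real" where
  "RL_kernel a u = rGamma a * tpow (a - 1) u"

text \<open>A piecewise linear cutoff: \<open>0\<close> for \<open>u \<le> \<epsilon>\<close> and \<open>1\<close> for \<open>u \<ge> 2 * \<epsilon>\<close>.\<close>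

definition RL_cutoff :: "real \<Rightarrow> real \<Rightarrow> real" where
  "RL_cutoff \<epsilon> u = min 1 (max 0 (u / \<epsilon> - 1))"

text \<open>The kernel with its singularity cut off. Replacing \<open>u\<close> by \<open>max u \<epsilon>\<close> does not change the
  product, as the cutoff vanishes for \<open>u \<le> \<epsilon>\<close>, but makes both factors bounded and Lipschitz for all
  \<open>u \<le> 1\<close>.\<close>

definition RL_regular :: "real \<Rightarrow> real \<Rightarrow> real \<Rightarrow> real" where
  "RL_regular \<epsilon> a u = rGamma a * max u \<epsilon> powr (a - 1) * RL_cutoff \<epsilon> u"

lemma rGamma_measurable [measurable (raw)]:
  assumes "f \<in> borel_measurable M"
  shows "(\<lambda>x. rGamma (f x) :: real) \<in> borel_measurable M"
  using measurable_compose[OF assms borel_measurable_continuous_onI[OF continuous_on_rGamma]] .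

lemma RL_kernel_measurable [measurable (raw)]:
  assumes [measurable]: "f \<in> borel_measurable M" "g \<in> borel_measurable M"
  shows "(\<lambda>x. RL_kernel (f x) (g x)) \<in> borel_measurable M"
  unfolding RL_kernel_def by measurable

lemma RL_regular_measurable [measurable (raw)]:
  assumes [measurable]: "f \<in> borel_measurable M" "g \<in> borel_measurable M"
  shows "(\<lambda>x. RL_regular \<epsilon> (f x) (g x)) \<in> borel_measurable M"
  unfolding RL_regular_def RL_cutoff_def by measurable

lemma RL_cutoff_bounds: "0 \<le> RL_cutoff \<epsilon> u" "RL_cutoff \<epsilon> u \<le> 1"
  by (auto simp: RL_cutoff_def)

lemma RL_cutoff_lipschitz:
  assumes "0 < \<epsilon>"
  shows "\<bar>RL_cutoff \<epsilon> u - RL_cutoff \<epsilon> v\<bar> \<le> (1 / \<epsilon>) * \<bar>u - v\<bar>"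
proof -
  have "\<bar>RL_cutoff \<epsilon> u - RL_cutoff \<epsilon> v\<bar> \<le> \<bar>u / \<epsilon> - v / \<epsilon>\<bar>"
    by (auto simp: RL_cutoff_def min_def max_def)
  also have "\<dots> = (1 / \<epsilon>) * \<bar>u - v\<bar>"
    using assms by (simp add: diff_divide_distrib[symmetric] abs_divide)
  finally show ?thesis .
qed

lemma powr_lipschitz:
  fixes x y a \<epsilon> :: real
  assumes a: "0 < a" and \<epsilon>: "0 < \<epsilon>" and x: "x \<in> {\<epsilon>..1}" and y: "y \<in> {\<epsilon>..1}"
  shows "\<bar>x powr (a - 1) - y powr (a - 1)\<bar> \<le> \<bar>a - 1\<bar> * \<epsilon> powr (-2) * \<bar>x - y\<bar>"
proof -
  have "norm (x powr (a - 1) - y powr (a - 1)) \<le> (\<bar>a - 1\<bar> * \<epsilon> powr (-2)) * norm (x - y)"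
  proof (rule field_differentiable_bound[of "{\<epsilon>..1}"])
    fix z assume z: "z \<in> {\<epsilon>..1}"
    then show "((\<lambda>z. z powr (a - 1)) has_field_derivative (a - 1) * z powr (a - 1 - 1)) (at z within {\<epsilon>..1})"
      using \<epsilon> by (auto intro!: derivative_eq_intros)
    have "z powr (a - 1 - 1) \<le> z powr (-2)" using z \<epsilon> a by (intro powr_mono') auto
    also have "\<dots> \<le> \<epsilon> powr (-2)" using z \<epsilon> by (intro powr_mono2') auto
    finally show "norm ((a - 1) * z powr (a - 1 - 1)) \<le> \<bar>a - 1\<bar> * \<epsilon> powr (-2)"
      by (simp add: abs_mult mult_left_mono)
  qed (use x y in auto)
  then show ?thesis by simp
qed

context
  fixes B :: real
  assumes B: "0 < B" "\<And>x. 0 < x \<Longrightarrow> 0 \<le> rGamma x \<and> rGamma x \<le> B \<and> \<bar>x - 1\<bar> * rGamma x \<le> B"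
begin

lemma RL_kernel_le:
  assumes "0 < a0" "a0 \<le> a" "u \<le> 1"
  shows "0 \<le> RL_kernel a u" "RL_kernel a u \<le> B * tpow (a0 - 1) u"
proof -
  have "0 \<le> RL_kernel a u \<and> RL_kernel a u \<le> B * tpow (a0 - 1) u"
    using assms B unfolding RL_kernel_def tpow_def
    by (auto intro!: mult_mono powr_mono')
  then show "0 \<le> RL_kernel a u" "RL_kernel a u \<le> B * tpow (a0 - 1) u" by auto
qed

lemma RL_regular_factor_le:
  assumes a: "0 < a" and \<epsilon>: "0 < \<epsilon>" "\<epsilon> \<le> 1" and u: "u \<le> 1"
  shows "0 \<le> rGamma a * max u \<epsilon> powr (a - 1)" "rGamma a * max u \<epsilon> powr (a - 1) \<le> B / \<epsilon>"
proof -
  have "max u \<epsilon> powr (a - 1) \<le> max u \<epsilon> powr (-1)" using assms by (intro powr_mono') auto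
  also have "\<dots> \<le> \<epsilon> powr (-1)" using \<epsilon> by (intro powr_mono2') auto
  also have "\<dots> = 1 / \<epsilon>" using \<epsilon> by (simp add: powr_minus_divide)
  finally have "rGamma a * max u \<epsilon> powr (a - 1) \<le> B * (1 / \<epsilon>)"
    using B a by (intro mult_mono) auto
  then show "rGamma a * max u \<epsilon> powr (a - 1) \<le> B / \<epsilon>" by simp
  show "0 \<le> rGamma a * max u \<epsilon> powr (a - 1)" using B(2)[OF a] by simp
qed

lemma RL_regular_le:
  assumes "0 < a" "0 < \<epsilon>" "\<epsilon> \<le> 1" "u \<le> 1"
  shows "\<bar>RL_regular \<epsilon> a u\<bar> \<le> B / \<epsilon>"
proof -
  have "RL_regular \<epsilon> a u \<le> B / \<epsilon> * 1"
    unfolding RL_regular_def using RL_regular_factor_le[OF assms] RL_cutoff_bounds[of \<epsilon> u] B assms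
    by (intro mult_mono) auto
  moreover have "0 \<le> RL_regular \<epsilon> a u"
    unfolding RL_regular_def using RL_regular_factor_le[OF assms] RL_cutoff_bounds[of \<epsilon> u] by simp
  ultimately show ?thesis by simp
qed

lemma RL_regular_lipschitz:
  assumes a: "0 < a" and \<epsilon>: "0 < \<epsilon>" "\<epsilon> \<le> 1" and u: "u \<le> 1" and v: "v \<le> 1"
  shows "\<bar>RL_regular \<epsilon> a u - RL_regular \<epsilon> a v\<bar> \<le> 2 * B / \<epsilon>\<^sup>2 * \<bar>u - v\<bar>"
proof -
  define g where "g u = rGamma a * max u \<epsilon> powr (a - 1)" for u
  have "\<bar>g u - g v\<bar> = rGamma a * \<bar>max u \<epsilon> powr (a - 1) - max v \<epsilon> powr (a - 1)\<bar>"
    using B(2)[OF a] by (simp add: g_def right_diff_distrib[symmetric] abs_mult)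
  also have "\<dots> \<le> rGamma a * (\<bar>a - 1\<bar> * \<epsilon> powr (-2) * \<bar>max u \<epsilon> - max v \<epsilon>\<bar>)"
    using B(2)[OF a] u v \<epsilon> by (intro mult_left_mono powr_lipschitz a) auto
  also have "\<dots> = (\<bar>a - 1\<bar> * rGamma a) * (\<epsilon> powr (-2) * \<bar>max u \<epsilon> - max v \<epsilon>\<bar>)"
    by simp
  also have "\<dots> \<le> B * (\<epsilon> powr (-2) * \<bar>u - v\<bar>)"
    using B(1) B(2)[OF a] by (intro mult_mono) (auto simp: max_def)
  also have "\<dots> = B / \<epsilon>\<^sup>2 * \<bar>u - v\<bar>"
    using \<epsilon> by (simp add: powr_minus_divide)
  finally have g: "\<bar>g u - g v\<bar> \<le> B / \<epsilon>\<^sup>2 * \<bar>u - v\<bar>" .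
  have gv: "\<bar>g v\<bar> \<le> B / \<epsilon>" using RL_regular_factor_le[OF a \<epsilon> v] by (simp add: g_def)
  have "RL_regular \<epsilon> a u - RL_regular \<epsilon> a v
      = (g u - g v) * RL_cutoff \<epsilon> u + g v * (RL_cutoff \<epsilon> u - RL_cutoff \<epsilon> v)"
    by (simp add: RL_regular_def g_def algebra_simps)
  also have "\<bar>\<dots>\<bar> \<le> \<bar>g u - g v\<bar> * \<bar>RL_cutoff \<epsilon> u\<bar> + \<bar>g v\<bar> * \<bar>RL_cutoff \<epsilon> u - RL_cutoff \<epsilon> v\<bar>"
    by (metis abs_mult abs_triangle_ineq)
  also have "\<dots> \<le> (B / \<epsilon>\<^sup>2 * \<bar>u - v\<bar>) * 1 + B / \<epsilon> * ((1 / \<epsilon>) * \<bar>u - v\<bar>)"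
    using g gv RL_cutoff_bounds[of \<epsilon> u] RL_cutoff_lipschitz[OF \<epsilon>(1)] B \<epsilon>
    by (intro add_mono mult_mono) auto
  also have "\<dots> = 2 * B / \<epsilon>\<^sup>2 * \<bar>u - v\<bar>"
    by (simp add: power2_eq_square)
  finally show ?thesis .
qed

text \<open>The two kernels differ only for \<open>0 < u < 2 * \<epsilon>\<close>, where a factor \<open>u powr \<eta>\<close> can be split off and
  bounded by \<open>(2 * \<epsilon>) powr \<eta>\<close>.\<close>

lemma RL_regular_close:
  assumes a: "0 < a0" "a0 \<le> a" and \<epsilon>: "0 < \<epsilon>" "\<epsilon> \<le> 1" and u: "u \<le> 1" and \<eta>: "0 < \<eta>"
  shows "\<bar>RL_kernel a u - RL_regular \<epsilon> a u\<bar> \<le> B * (2 * \<epsilon>) powr \<eta> * tpow (a0 - \<eta> - 1) u"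
proof -
  consider "2 * \<epsilon> \<le> u" | "u \<le> 0" | "0 < u" "u < 2 * \<epsilon>" by linarith
  then show ?thesis
  proof cases
    case 1
    then have "2 \<le> u / \<epsilon>" using \<epsilon> by (simp add: field_simps)
    then have "RL_cutoff \<epsilon> u = 1" by (simp add: RL_cutoff_def)
    moreover have "max u \<epsilon> = u" "0 < u" using 1 \<epsilon> by auto
    ultimately have "RL_kernel a u = RL_regular \<epsilon> a u"
      by (simp add: RL_kernel_def RL_regular_def tpow_def)
    then show ?thesis using B by simp
  next
    case 2
    then have "u / \<epsilon> \<le> 0" using \<epsilon> by (simp add: field_simps)
    then have "RL_cutoff \<epsilon> u = 0" by (simp add: RL_cutoff_def)
    then show ?thesis using 2 by (simp add: RL_kernel_def RL_regular_def tpow_def)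
  next
    case 3
    have reg: "RL_regular \<epsilon> a u = RL_kernel a u * RL_cutoff \<epsilon> u"
    proof (cases "u \<le> \<epsilon>")
      case True
      then have "u / \<epsilon> \<le> 1" using \<epsilon> by (simp add: field_simps)
      then have "RL_cutoff \<epsilon> u = 0" by (simp add: RL_cutoff_def)
      then show ?thesis by (simp add: RL_regular_def)
    qed (use 3 in \<open>simp add: RL_regular_def RL_kernel_def tpow_def max_def\<close>)
    have "\<bar>RL_kernel a u - RL_regular \<epsilon> a u\<bar> = RL_kernel a u * (1 - RL_cutoff \<epsilon> u)"
      using RL_kernel_le[OF a u] RL_cutoff_bounds[of \<epsilon> u]
      by (simp add: reg right_diff_distrib mult_left_le)
    also have "\<dots> \<le> RL_kernel a u * 1"
      using RL_kernel_le[OF a u] RL_cutoff_bounds[of \<epsilon> u] by (intro mult_left_mono) auto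
    also have "\<dots> \<le> B * tpow (a0 - 1) u" using RL_kernel_le[OF a u] by simp
    also have "tpow (a0 - 1) u = u powr \<eta> * tpow (a0 - \<eta> - 1) u"
      using 3 by (simp add: tpow_def powr_add[symmetric])
    also have "B * \<dots> \<le> B * ((2 * \<epsilon>) powr \<eta> * tpow (a0 - \<eta> - 1) u)"
      using 3 B \<eta> by (intro mult_left_mono mult_right_mono powr_mono2) auto
    finally show ?thesis by (simp add: mult.assoc)
  qed
qed

end

lemma RL_integral_eq:
  assumes t: "t \<in> {0..1}"
  shows "RL_integral \<alpha> f t = (\<integral>s. RL_kernel (\<alpha> t) (t - s) * f s \<partial>I01)"
proof -
  have "(\<integral>s. RL_kernel (\<alpha> t) (t - s) * f s \<partial>I01)
      = (\<integral>s. indicator {0..1} s *\<^sub>R (RL_kernel (\<alpha> t) (t - s) * f s) \<partial>lebesgue)"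
    by (rule integral_restrict_space) simp
  also have "\<dots> = (\<integral>s. 1 / Gamma (\<alpha> t) * (indicator {0..t} s *\<^sub>R ((t - s) powr (\<alpha> t - 1) * f s)) \<partial>lebesgue)"
    using t by (intro Bochner_Integration.integral_cong refl)
      (auto simp: RL_kernel_def tpow_def rGamma_inverse_Gamma indicator_def divide_inverse)
  also have "\<dots> = RL_integral \<alpha> f t"
    unfolding RL_integral_def set_lebesgue_integral_def by (rule integral_mult_right_zero)
  finally show ?thesis by simp
qed

section \<open>The operator of variable order\<close>

text \<open>Orders \<open>\<alpha>\<close> with a positive lower bound \<open>a0\<close>, which need not be the infimum.\<close>

locale RL_order =
  fixes \<alpha> :: "real \<Rightarrow> real" and a0 :: real
  assumes \<alpha>_measurable [measurable]: "\<alpha> \<in> borel_measurable I01"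
    and a0_pos: "0 < a0" and a0_le: "\<And>t. t \<in> {0..1} \<Longrightarrow> a0 \<le> \<alpha> t"
begin

lemma RL_integral_measurable [measurable]:
  assumes [measurable]: "f \<in> borel_measurable I01"
  shows "RL_integral \<alpha> f \<in> borel_measurable I01"
proof -
  have "(\<lambda>t. \<integral>s. RL_kernel (\<alpha> t) (t - s) * f s \<partial>I01) \<in> borel_measurable I01"
    by measurable
  then show ?thesis
    by (subst measurable_cong[where g="\<lambda>t. \<integral>s. RL_kernel (\<alpha> t) (t - s) * f s \<partial>I01"])
      (auto simp: RL_integral_eq space_restrict_space)
qed

lemma RL_kernel_integrable_AE:
  assumes f: "integrable I01 f"
  shows "AE t in I01. integrable I01 (\<lambda>s. tpow (a0 - 1) (t - s) * \<bar>f s\<bar>)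
    \<and> integrable I01 (\<lambda>s. RL_kernel (\<alpha> t) (t - s) * f s)"
proof -
  have [measurable]: "f \<in> borel_measurable I01" using f by auto
  from rGamma_bounded obtain B :: real where "0 < B"
    and "\<forall>x. 0 < x \<longrightarrow> 0 \<le> rGamma x \<and> rGamma x \<le> B \<and> \<bar>x - 1\<bar> * rGamma x \<le> B"
    by (elim exE conjE)
  note B = this(1) this(2)[rule_format]
  have "-1 < a0 - 1" using a0_pos by simp
  from tpow_convolution(1)[OF this integrable_abs[OF f] abs_ge_zero] AE_space
  show ?thesis
  proof eventually_elim
    case (elim t)
    then have t: "t \<in> {0..1}" by (simp add: space_restrict_space)
    have "integrable I01 (\<lambda>s. RL_kernel (\<alpha> t) (t - s) * f s)"
    proof (rule Bochner_Integration.integrable_bound)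
      show "integrable I01 (\<lambda>s. B * (tpow (a0 - 1) (t - s) * \<bar>f s\<bar>))" using elim by simp
      show "AE s in I01. norm (RL_kernel (\<alpha> t) (t - s) * f s) \<le> norm (B * (tpow (a0 - 1) (t - s) * \<bar>f s\<bar>))"
      proof (rule AE_I2)
        fix s assume "s \<in> space I01"
        then have "t - s \<le> 1" using t by (simp add: space_restrict_space)
        from RL_kernel_le[OF B a0_pos a0_le[OF t] this] B(1)
        show "norm (RL_kernel (\<alpha> t) (t - s) * f s) \<le> norm (B * (tpow (a0 - 1) (t - s) * \<bar>f s\<bar>))"
          by (simp add: abs_mult mult.assoc[symmetric] mult_right_mono)
      qed
    qed measurable
    then show ?case using elim by simp
  qed
qed

lemma RL_integral_linear_AE:
  assumes f: "integrable I01 f" and g: "integrable I01 g"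
  shows "AE t in I01. RL_integral \<alpha> (\<lambda>x. a * f x + b * g x) t = a * RL_integral \<alpha> f t + b * RL_integral \<alpha> g t"
  using RL_kernel_integrable_AE[OF f] RL_kernel_integrable_AE[OF g] AE_space
proof eventually_elim
  case (elim t)
  then have t: "t \<in> {0..1}" by (simp add: space_restrict_space)
  have "(\<integral>s. RL_kernel (\<alpha> t) (t - s) * (a * f s + b * g s) \<partial>I01)
      = (\<integral>s. a * (RL_kernel (\<alpha> t) (t - s) * f s) + b * (RL_kernel (\<alpha> t) (t - s) * g s) \<partial>I01)"
    by (intro Bochner_Integration.integral_cong refl) (simp add: algebra_simps)
  then show ?case using elim by (simp add: RL_integral_eq[OF t])
qed

lemma RL_integral_le_potential_AE:
  assumes f: "integrable I01 f"
  shows "\<exists>B>0. AE t in I01. \<bar>RL_integral \<alpha> f t\<bar> \<le> B * RL_potential a0 f t"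
proof -
  from rGamma_bounded obtain B :: real where "0 < B"
    and "\<forall>x. 0 < x \<longrightarrow> 0 \<le> rGamma x \<and> rGamma x \<le> B \<and> \<bar>x - 1\<bar> * rGamma x \<le> B"
    by (elim exE conjE)
  note B = this(1) this(2)[rule_format]
  have "AE t in I01. \<bar>RL_integral \<alpha> f t\<bar> \<le> B * RL_potential a0 f t"
    using RL_kernel_integrable_AE[OF f] AE_space
  proof eventually_elim
    case (elim t)
    then have t: "t \<in> {0..1}" by (simp add: space_restrict_space)
    have "\<bar>RL_integral \<alpha> f t\<bar> \<le> (\<integral>s. \<bar>RL_kernel (\<alpha> t) (t - s) * f s\<bar> \<partial>I01)"
      unfolding RL_integral_eq[OF t] by (rule integral_abs_bound)
    also have "\<dots> \<le> (\<integral>s. B * (tpow (a0 - 1) (t - s) * \<bar>f s\<bar>) \<partial>I01)"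
    proof (rule integral_mono)
      fix s assume "s \<in> space I01"
      then have "t - s \<le> 1" using t by (simp add: space_restrict_space)
      from RL_kernel_le[OF B a0_pos a0_le[OF t] this]
      show "\<bar>RL_kernel (\<alpha> t) (t - s) * f s\<bar> \<le> B * (tpow (a0 - 1) (t - s) * \<bar>f s\<bar>)"
        by (simp add: abs_mult mult.assoc[symmetric] mult_right_mono)
    qed (use elim in auto)
    finally show ?case by (simp add: RL_potential_def)
  qed
  then show ?thesis using B by blast
qed

lemma RL_integral_in_lp_space:
  assumes p: "1 \<le> p" and pq: "ereal p \<le> q" and a: "1 / ereal p - 1 / q < ereal a0"
    and f: "f \<in> lp_space I01 (ereal p)"
  shows "RL_integral \<alpha> f \<in> lp_space I01 q"
proof -
  have q: "1 \<le> q" using p pq by (metis ereal_less_eq(3) one_ereal_def order_trans)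
  have f1: "integrable I01 f" using p f by (intro I01.lp_space_integrable[of "ereal p"]) (auto simp: one_ereal_def)
  note [measurable] = lp_space_measurable[OF f]
  obtain B where B: "0 < B" "AE t in I01. \<bar>RL_integral \<alpha> f t\<bar> \<le> B * RL_potential a0 f t"
    using RL_integral_le_potential_AE[OF f1] by auto
  have "RL_potential a0 f \<in> lp_space I01 q"
    using RL_potential_bounded[OF p pq a, of "lp_norm I01 (ereal p) f + 1"] f lp_norm_nonneg[of I01 "ereal p" f]
    by auto
  then have "(\<lambda>t. B * RL_potential a0 f t) \<in> lp_space I01 q" by (rule lp_space_cmult[OF q])
  then show ?thesis
  proof (rule lp_space_mono(1)[OF q])
    show "AE t in I01. \<bar>RL_integral \<alpha> f t\<bar> \<le> \<bar>B * RL_potential a0 f t\<bar>"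
      using B(2) by eventually_elim (use abs_ge_self order_trans in blast)
  qed measurable
qed

text \<open>In the regularised kernel, \<open>s\<close> may be replaced by the left end point \<open>\<lfloor>n * s\<rfloor> / n\<close> of its cell,
  at the cost of the Lipschitz constant divided by \<open>n\<close>.\<close>

lemma RL_step_kernel_close:
  assumes B: "0 < B" "\<And>x. 0 < x \<Longrightarrow> 0 \<le> rGamma x \<and> rGamma x \<le> B \<and> \<bar>x - 1\<bar> * rGamma x \<le> B"
    and \<epsilon>: "0 < \<epsilon>" "\<epsilon> \<le> 1" and \<eta>: "0 < \<eta>" and n: "0 < n"
    and t: "t \<in> {0..1}" and s: "s \<in> {0..1}"
  shows "\<bar>RL_kernel (\<alpha> t) (t - s) - RL_regular \<epsilon> (\<alpha> t) (t - \<lfloor>real n * s\<rfloor> / real n)\<bar>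
    \<le> B * (2 * \<epsilon>) powr \<eta> * tpow (a0 - \<eta> - 1) (t - s) + 2 * B / \<epsilon>\<^sup>2 / real n"
proof -
  have \<alpha>: "0 < \<alpha> t" using a0_pos a0_le[OF t] by simp
  define x where "x = \<lfloor>real n * s\<rfloor> / real n"
  have x: "0 \<le> x" "\<bar>x - s\<bar> \<le> 1 / real n"
  proof -
    show "0 \<le> x" using s by (simp add: x_def)
    have "x - s = (\<lfloor>real n * s\<rfloor> - real n * s) / real n" using n by (simp add: x_def diff_divide_distrib)
    moreover have "\<bar>\<lfloor>real n * s\<rfloor> - real n * s\<bar> \<le> 1" by linarith
    ultimately show "\<bar>x - s\<bar> \<le> 1 / real n" using n by (simp add: divide_right_mono)
  qed
  have "\<bar>RL_regular \<epsilon> (\<alpha> t) (t - s) - RL_regular \<epsilon> (\<alpha> t) (t - x)\<bar> \<le> 2 * B / \<epsilon>\<^sup>2 * \<bar>(t - s) - (t - x)\<bar>"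
    using t s x by (intro RL_regular_lipschitz[OF B] \<alpha> \<epsilon>) auto
  also have "\<dots> \<le> 2 * B / \<epsilon>\<^sup>2 * (1 / real n)"
    using x B by (intro mult_left_mono) auto
  finally have 1: "\<bar>RL_regular \<epsilon> (\<alpha> t) (t - s) - RL_regular \<epsilon> (\<alpha> t) (t - x)\<bar> \<le> 2 * B / \<epsilon>\<^sup>2 / real n"
    by simp
  have "\<bar>RL_kernel (\<alpha> t) (t - s) - RL_regular \<epsilon> (\<alpha> t) (t - s)\<bar> \<le> B * (2 * \<epsilon>) powr \<eta> * tpow (a0 - \<eta> - 1) (t - s)"
    using t s by (intro RL_regular_close[OF B] a0_pos a0_le \<epsilon> \<eta>) auto
  with 1 show ?thesis unfolding x_def[symmetric] by linarith
qed

text \<open>The integral of \<open>h\<close> over the cell \<open>{j / n ..< (j + 1) / n}\<close> of the unit interval, for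
  \<open>n > 0\<close>; the cell with \<open>j = n\<close> is the point \<open>1\<close>.\<close>

definition cell_integral :: "nat \<Rightarrow> (real \<Rightarrow> real) \<Rightarrow> nat \<Rightarrow> real" where
  "cell_integral n h j = (\<integral>s. indicator {s. \<lfloor>real n * s\<rfloor> = int j} s * h s \<partial>I01)"

lemma cell_integrable:
  fixes h :: "real \<Rightarrow> real"
  assumes "integrable I01 h"
  shows "integrable I01 (\<lambda>s. indicator {s. \<lfloor>real n * s\<rfloor> = int j} s * h s)"
proof -
  have [measurable]: "h \<in> borel_measurable I01" using assms by auto
  show ?thesis
    by (rule Bochner_Integration.integrable_bound[OF assms]) (auto simp: indicator_def)
qed

text \<open>Split the kernel into its step approximation and the error. The integral of \<open>h\<close> against the step
  kernel is a combination of the cell integrals with coefficients bounded by \<open>B / \<epsilon>\<close>.\<close>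

lemma RL_integral_small_AE:
  assumes B: "0 < B" "\<And>x. 0 < x \<Longrightarrow> 0 \<le> rGamma x \<and> rGamma x \<le> B \<and> \<bar>x - 1\<bar> * rGamma x \<le> B"
    and \<epsilon>: "0 < \<epsilon>" "\<epsilon> \<le> 1" and \<eta>: "0 < \<eta>" "\<eta> < a0" and n: "0 < n"
    and h: "integrable I01 h" and \<delta>: "\<And>j. j \<le> n \<Longrightarrow> \<bar>cell_integral n h j\<bar> \<le> \<delta>"
  shows "AE t in I01. \<bar>RL_integral \<alpha> h t\<bar> \<le> B * (2 * \<epsilon>) powr \<eta> * RL_potential (a0 - \<eta>) h t
    + (2 * B / \<epsilon>\<^sup>2 / real n * (\<integral>s. \<bar>h s\<bar> \<partial>I01) + real (Suc n) * (B / \<epsilon> * \<delta>))"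
proof -
  have [measurable]: "h \<in> borel_measurable I01" using h by auto
  have "-1 < a0 - \<eta> - 1" using \<eta> by simp
  from RL_kernel_integrable_AE[OF h] tpow_convolution(1)[OF this integrable_abs[OF h] abs_ge_zero] AE_space
  show ?thesis
  proof eventually_elim
    case (elim t)
    then have t: "t \<in> {0..1}" by (simp add: space_restrict_space)
    have \<alpha>: "0 < \<alpha> t" using a0_pos a0_le[OF t] by simp
    let ?k = "\<lambda>s. RL_regular \<epsilon> (\<alpha> t) (t - \<lfloor>real n * s\<rfloor> / real n)"
    let ?c = "\<lambda>j. RL_regular \<epsilon> (\<alpha> t) (t - real j / real n)"
    let ?i = "\<lambda>j s. indicat_real {s. \<lfloor>real n * s\<rfloor> = int j} s * h s"
    have step: "?k s * h s = (\<Sum>j\<le>n. ?c j * ?i j s)" if "s \<in> {0..1}" for s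
    proof -
      have *: "nat \<lfloor>real n * s\<rfloor> \<le> n"
      proof -
        have "real n * s \<le> real n" using that by (simp add: mult_left_le)
        then show ?thesis by linarith
      qed
      have **: "0 \<le> \<lfloor>real n * s\<rfloor>" using that by simp
      have "(\<Sum>j\<le>n. ?c j * ?i j s) = (\<Sum>j\<le>n. if j = nat \<lfloor>real n * s\<rfloor> then ?c j * h s else 0)"
        using ** by (intro sum.cong) (auto simp: indicator_def)
      also have "\<dots> = ?k s * h s" using * ** by simp
      finally show ?thesis by simp
    qed
    have int_sum: "integrable I01 (\<lambda>s. \<Sum>j\<le>n. ?c j * ?i j s)"
      by (intro Bochner_Integration.integrable_sum integrable_mult_right cell_integrable h)
    then have int_k: "integrable I01 (\<lambda>s. ?k s * h s)"
      by (subst Bochner_Integration.integrable_cong[OF refl step]) (auto simp: space_restrict_space)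
    have "\<bar>\<integral>s. ?k s * h s \<partial>I01\<bar> = \<bar>\<Sum>j\<le>n. ?c j * cell_integral n h j\<bar>"
    proof -
      have "(\<integral>s. ?k s * h s \<partial>I01) = (\<integral>s. (\<Sum>j\<le>n. ?c j * ?i j s) \<partial>I01)"
        by (intro Bochner_Integration.integral_cong refl step) (simp add: space_restrict_space)
      also have "\<dots> = (\<Sum>j\<le>n. ?c j * cell_integral n h j)"
        by (subst Bochner_Integration.integral_sum) (auto simp: cell_integral_def intro!: cell_integrable h)
      finally show ?thesis by simp
    qed
    also have "\<dots> \<le> (\<Sum>j\<le>n. \<bar>?c j\<bar> * \<bar>cell_integral n h j\<bar>)"
      by (rule order_trans[OF sum_abs]) (simp add: abs_mult)
    also have "\<dots> \<le> (\<Sum>j\<le>n. B / \<epsilon> * \<delta>)"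
    proof (intro sum_mono mult_mono)
      fix j assume j: "j \<in> {..n}"
      have "t - real j / real n \<le> 1" using t by (smt (verit) atLeastAtMost_iff divide_nonneg_nonneg of_nat_0_le_iff)
      then show "\<bar>?c j\<bar> \<le> B / \<epsilon>" by (intro RL_regular_le[OF B] \<alpha> \<epsilon>)
      show "\<bar>cell_integral n h j\<bar> \<le> \<delta>" using \<delta> j by simp
    qed (use B \<epsilon> in auto)
    also have "\<dots> = real (Suc n) * (B / \<epsilon> * \<delta>)" by simp
    finally have 1: "\<bar>\<integral>s. ?k s * h s \<partial>I01\<bar> \<le> real (Suc n) * (B / \<epsilon> * \<delta>)" .
    let ?K = "\<lambda>s. RL_kernel (\<alpha> t) (t - s)"
    have int_K: "integrable I01 (\<lambda>s. ?K s * h s)" using elim by simp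
    have "\<bar>\<integral>s. ?K s * h s - ?k s * h s \<partial>I01\<bar> \<le> (\<integral>s. \<bar>?K s * h s - ?k s * h s\<bar> \<partial>I01)"
      by (rule integral_abs_bound)
    also have "\<dots> \<le> (\<integral>s. B * (2 * \<epsilon>) powr \<eta> * (tpow (a0 - \<eta> - 1) (t - s) * \<bar>h s\<bar>) + 2 * B / \<epsilon>\<^sup>2 / real n * \<bar>h s\<bar> \<partial>I01)"
    proof (rule integral_mono)
      show "integrable I01 (\<lambda>s. B * (2 * \<epsilon>) powr \<eta> * (tpow (a0 - \<eta> - 1) (t - s) * \<bar>h s\<bar>) + 2 * B / \<epsilon>\<^sup>2 / real n * \<bar>h s\<bar>)"
        using elim h by (intro Bochner_Integration.integrable_add integrable_mult_right integrable_abs) auto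
      show "integrable I01 (\<lambda>s. \<bar>?K s * h s - ?k s * h s\<bar>)"
        using int_K int_k by (intro integrable_abs Bochner_Integration.integrable_diff)
      fix s assume "s \<in> space I01"
      then have s: "s \<in> {0..1}" by (simp add: space_restrict_space)
      have "\<bar>?K s * h s - ?k s * h s\<bar> = \<bar>?K s - ?k s\<bar> * \<bar>h s\<bar>"
        by (simp add: left_diff_distrib[symmetric] abs_mult)
      also have "\<dots> \<le> (B * (2 * \<epsilon>) powr \<eta> * tpow (a0 - \<eta> - 1) (t - s) + 2 * B / \<epsilon>\<^sup>2 / real n) * \<bar>h s\<bar>"
        by (rule mult_right_mono[OF RL_step_kernel_close[OF B \<epsilon> \<eta>(1) n t s] abs_ge_zero])
      finally show "\<bar>?K s * h s - ?k s * h s\<bar>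
        \<le> B * (2 * \<epsilon>) powr \<eta> * (tpow (a0 - \<eta> - 1) (t - s) * \<bar>h s\<bar>) + 2 * B / \<epsilon>\<^sup>2 / real n * \<bar>h s\<bar>"
        by (simp add: distrib_right mult.assoc)
    qed
    also have "\<dots> = B * (2 * \<epsilon>) powr \<eta> * RL_potential (a0 - \<eta>) h t + 2 * B / \<epsilon>\<^sup>2 / real n * (\<integral>s. \<bar>h s\<bar> \<partial>I01)"
      unfolding RL_potential_def using elim h
      by (subst Bochner_Integration.integral_add) auto
    finally have 2: "\<bar>\<integral>s. ?K s * h s - ?k s * h s \<partial>I01\<bar> \<le> \<dots>" .
    have "RL_integral \<alpha> h t = (\<integral>s. ?K s * h s - ?k s * h s \<partial>I01) + (\<integral>s. ?k s * h s \<partial>I01)"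
      using int_K int_k by (simp add: RL_integral_eq[OF t])
    then have "\<bar>RL_integral \<alpha> h t\<bar> \<le> B * (2 * \<epsilon>) powr \<eta> * RL_potential (a0 - \<eta>) h t
      + (2 * B / \<epsilon>\<^sup>2 / real n * (\<integral>s. \<bar>h s\<bar> \<partial>I01) + real (Suc n) * (B / \<epsilon> * \<delta>))"
      using 1 2 by linarith
    then show ?case by simp
  qed
qed

end

section \<open>Total boundedness and compactness\<close>

text \<open>A criterion for total boundedness of an image: for each \<open>e > 0\<close> the domain can be sorted into
  finitely many classes, here the fibres of \<open>c\<close>, with images of diameter less than \<open>e\<close>.\<close>

lemma mtotally_bounded_image_by_codes:
  assumes "Metric_space M d" and PA: "P ` A \<subseteq> M"
    and codes: "\<And>e. 0 < e \<Longrightarrow>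
      \<exists>c::'b \<Rightarrow> 'c. finite (c ` A) \<and> (\<forall>x\<in>A. \<forall>y\<in>A. c x = c y \<longrightarrow> d (P x) (P y) < e)"
  shows "Metric_space.mtotally_bounded M d (P ` A)"
proof -
  interpret Metric_space M d by fact
  show ?thesis
    unfolding mtotally_bounded_def
  proof (intro allI impI)
    fix e :: real assume "0 < e"
    then obtain c :: "'b \<Rightarrow> 'c" where fin: "finite (c ` A)"
      and close: "\<And>x y. x \<in> A \<Longrightarrow> y \<in> A \<Longrightarrow> c x = c y \<Longrightarrow> d (P x) (P y) < e"
      using codes by meson
    define r where "r z = (SOME x. x \<in> A \<and> c x = z)" for z
    have r: "r (c x) \<in> A \<and> c (r (c x)) = c x" if "x \<in> A" for x
      unfolding r_def by (rule someI[of "\<lambda>y. y \<in> A \<and> c y = c x" x]) (use that in simp)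
    have "P ` A \<subseteq> (\<Union>x\<in>P ` r ` c ` A. mball x e)"
    proof (rule image_subsetI)
      fix x assume x: "x \<in> A"
      have "d (P (r (c x))) (P x) < e" using r[OF x] x by (intro close) auto
      moreover have "P (r (c x)) \<in> M" "P x \<in> M" using r[OF x] x PA by auto
      ultimately have "P x \<in> mball (P (r (c x))) e" by simp
      then show "P x \<in> (\<Union>x\<in>P ` r ` c ` A. mball x e)" using x by blast
    qed
    moreover have "P ` r ` c ` A \<subseteq> P ` A" using r by auto
    ultimately show "\<exists>K. finite K \<and> K \<subseteq> P ` A \<and> P ` A \<subseteq> (\<Union>x\<in>K. mball x e)"
      using fin by (intro exI[of _ "P ` r ` c ` A"]) auto
  qed
qed

context RL_order
begin

lemma cell_integral_diff:
  assumes "integrable I01 f" "integrable I01 g"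
  shows "cell_integral n (\<lambda>x. f x - g x) j = cell_integral n f j - cell_integral n g j"
  using cell_integrable[OF assms(1), of n j] cell_integrable[OF assms(2), of n j]
  by (simp add: cell_integral_def right_diff_distrib)

lemma cell_integral_le:
  assumes h: "integrable I01 h"
  shows "\<bar>cell_integral n h j\<bar> \<le> (\<integral>s. \<bar>h s\<bar> \<partial>I01)"
proof -
  have "\<bar>cell_integral n h j\<bar> \<le> (\<integral>s. \<bar>indicator {s. \<lfloor>real n * s\<rfloor> = int j} s * h s\<bar> \<partial>I01)"
    unfolding cell_integral_def by (rule integral_abs_bound)
  also have "\<dots> \<le> (\<integral>s. \<bar>h s\<bar> \<partial>I01)"
    using cell_integrable[OF h] h by (intro integral_mono integrable_abs) (auto simp: indicator_def)
  finally show ?thesis .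
qed

text \<open>The key estimate: on a ball, \<open>RL_integral \<alpha> h\<close> is small in \<open>L\<^sub>q\<close> if finitely many cell integrals
  of \<open>h\<close> are small.\<close>

lemma RL_integral_norm_small:
  assumes p: "1 \<le> p" and pq: "ereal p \<le> q" and a: "1 / ereal p - 1 / q < ereal a0"
    and R: "0 < R" and e: "0 < e"
  shows "\<exists>n \<delta>. 0 < \<delta> \<and> (\<forall>h\<in>lp_space I01 (ereal p). lp_norm I01 (ereal p) h \<le> R \<longrightarrow>
    (\<forall>j\<le>n. \<bar>cell_integral n h j\<bar> \<le> \<delta>) \<longrightarrow> lp_norm I01 q (RL_integral \<alpha> h) < e)"
proof -
  have p1: "1 \<le> ereal p" using p by (simp add: one_ereal_def)
  have q1: "1 \<le> q" using p1 pq by (rule order_trans)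
  obtain d where d: "0 \<le> d" "1 / ereal p - 1 / q = ereal d"
  proof (cases q)
    case (real r)
    then have "1 / r \<le> 1 / p" using p pq by (intro divide_left_mono) auto
    then show thesis using that[of "1 / p - 1 / r"] real p pq by (simp add: one_ereal_def)
  next
    case PInf
    then show thesis using that[of "1 / p"] p by (simp add: one_ereal_def)
  qed (use pq in simp)
  \<comment> \<open>Half of the room between \<open>a0\<close> and the critical order \<open>d\<close> pays for the factor \<open>(2 * \<epsilon>) powr \<eta>\<close>.\<close>
  define \<eta> where "\<eta> = (a0 - d) / 2"
  have \<eta>: "0 < \<eta>" "\<eta> < a0" and a': "1 / ereal p - 1 / q < ereal (a0 - \<eta>)"
    using a d a0_pos by (auto simp: \<eta>_def field_simps)
  from rGamma_bounded obtain B :: real where "0 < B"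
    and "\<forall>x. 0 < x \<longrightarrow> 0 \<le> rGamma x \<and> rGamma x \<le> B \<and> \<bar>x - 1\<bar> * rGamma x \<le> B"
    by (elim exE conjE)
  note B = this(1) this(2)[rule_format]
  obtain C where C: "0 \<le> C" "\<And>h. h \<in> lp_space I01 (ereal p) \<Longrightarrow> lp_norm I01 (ereal p) h \<le> R \<Longrightarrow>
      RL_potential (a0 - \<eta>) h \<in> lp_space I01 q \<and> lp_norm I01 q (RL_potential (a0 - \<eta>) h) \<le> C"
    using RL_potential_bounded[OF p pq a' R] by blast
  obtain \<epsilon> where \<epsilon>: "0 < \<epsilon>" "\<epsilon> \<le> 1" and small1: "B * (2 * \<epsilon>) powr \<eta> * C \<le> e / 4"
  proof -
    define K where "K = C + 1"
    define x where "x = e / 4 / B / K"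
    have K: "C \<le> K" "0 < K" using C(1) by (auto simp: K_def)
    then have x: "0 < x" using e B(1) by (simp add: x_def)
    define \<epsilon> where "\<epsilon> = min 1 (x powr (1 / \<eta>) / 2)"
    have \<epsilon>: "0 < \<epsilon>" "\<epsilon> \<le> 1" using x by (auto simp: \<epsilon>_def)
    have "(2 * \<epsilon>) powr \<eta> \<le> (x powr (1 / \<eta>)) powr \<eta>"
      using x \<eta> by (intro powr_mono2) (auto simp: \<epsilon>_def)
    then have "(2 * \<epsilon>) powr \<eta> \<le> x" using x \<eta> by (simp add: powr_powr)
    then have "B * (2 * \<epsilon>) powr \<eta> * C \<le> B * x * K"
      using B(1) C(1) K x by (intro mult_mono) auto
    also have "\<dots> = e / 4" using B(1) K by (simp add: x_def)
    finally show thesis using that[OF \<epsilon>] by blast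
  qed
  obtain n :: nat where n: "0 < n" and small2: "2 * B / \<epsilon>\<^sup>2 * R / real n \<le> e / 4"
  proof -
    define L where "L = 2 * B / \<epsilon>\<^sup>2 * R"
    have L: "0 < L" using B(1) R \<epsilon>(1) by (simp add: L_def)
    obtain n :: nat where n: "L / (e / 4) < real n" using reals_Archimedean2 by blast
    moreover have "0 < L / (e / 4)" using L e by simp
    ultimately have "0 < n" by (cases n) auto
    moreover have "L / real n \<le> e / 4"
      using n \<open>0 < n\<close> e by (simp add: field_simps)
    ultimately show thesis using that unfolding L_def by blast
  qed
  define \<delta> where "\<delta> = e / 4 / real (Suc n) / (B / \<epsilon>)"
  have \<delta>: "0 < \<delta>" using e B(1) \<epsilon>(1) by (simp add: \<delta>_def)
  have "B / \<epsilon> * \<delta> = e / 4 / real (Suc n)" using B(1) \<epsilon>(1) by (simp add: \<delta>_def)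
  then have small3: "real (Suc n) * (B / \<epsilon> * \<delta>) = e / 4"
    by (metis nonzero_mult_div_cancel_left of_nat_neq_0 times_divide_eq_right)
  show ?thesis
  proof (intro exI[of _ n] exI[of _ \<delta>] conjI ballI impI \<delta>)
    fix h assume h: "h \<in> lp_space I01 (ereal p)" and hR: "lp_norm I01 (ereal p) h \<le> R"
      and cells: "\<forall>j\<le>n. \<bar>cell_integral n h j\<bar> \<le> \<delta>"
    note [measurable] = lp_space_measurable[OF h]
    note h1 = I01.lp_space_integrable[OF p1 h]
    let ?J = "\<lambda>t. B * (2 * \<epsilon>) powr \<eta> * RL_potential (a0 - \<eta>) h t"
    have J: "?J \<in> lp_space I01 q" "lp_norm I01 q ?J \<le> e / 4"
    proof -
      have CJ: "RL_potential (a0 - \<eta>) h \<in> lp_space I01 q" "lp_norm I01 q (RL_potential (a0 - \<eta>) h) \<le> C"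
        using C(2)[OF h hR] by auto
      show "?J \<in> lp_space I01 q" by (rule lp_space_cmult[OF q1 CJ(1)])
      have "lp_norm I01 q ?J \<le> \<bar>B * (2 * \<epsilon>) powr \<eta>\<bar> * lp_norm I01 q (RL_potential (a0 - \<eta>) h)"
        by (rule lp_space_cmult[OF q1 CJ(1)])
      also have "\<dots> \<le> \<bar>B * (2 * \<epsilon>) powr \<eta>\<bar> * C" by (intro mult_left_mono CJ) simp
      also have "\<dots> \<le> e / 4" using small1 B by (simp add: abs_mult)
      finally show "lp_norm I01 q ?J \<le> e / 4" .
    qed
    have L: "2 * B / \<epsilon>\<^sup>2 / real n * (\<integral>s. \<bar>h s\<bar> \<partial>I01) \<le> e / 4"
    proof -
      have "2 * B / \<epsilon>\<^sup>2 / real n * (\<integral>s. \<bar>h s\<bar> \<partial>I01) \<le> 2 * B / \<epsilon>\<^sup>2 / real n * R"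
        using h1 hR B by (intro mult_left_mono) auto
      then show ?thesis using small2 by simp
    qed
    have sum: "(\<lambda>t. ?J t + e / 2) \<in> lp_space I01 q" "lp_norm I01 q (\<lambda>t. ?J t + e / 2) \<le> e / 4 + e / 2"
      using lp_space_add[OF q1 J(1) I01.lp_space_const(1)[OF q1, of "e / 2"]] J(2)
        I01.lp_space_const(2)[OF q1, of "e / 2"] e by auto
    have "AE t in I01. \<bar>RL_integral \<alpha> h t\<bar> \<le> \<bar>?J t + e / 2\<bar>"
    proof -
      have ae: "AE t in I01. \<bar>RL_integral \<alpha> h t\<bar>
        \<le> ?J t + (2 * B / \<epsilon>\<^sup>2 / real n * (\<integral>s. \<bar>h s\<bar> \<partial>I01) + real (Suc n) * (B / \<epsilon> * \<delta>))"
        using cells by (intro RL_integral_small_AE[OF B \<epsilon> \<eta> n h1(1)]) auto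
      have S: "2 * B / \<epsilon>\<^sup>2 / real n * (\<integral>s. \<bar>h s\<bar> \<partial>I01) + real (Suc n) * (B / \<epsilon> * \<delta>) \<le> e / 2"
        by (rule order_trans[OF add_mono[OF L eq_refl[OF small3]]]) simp
      from ae show ?thesis
        by eventually_elim (rule order_trans[OF order_trans[OF _ add_left_mono[OF S]] abs_ge_self])
    qed
    from lp_space_mono(2)[OF q1 sum(1) _ this] sum(2) e
    show "lp_norm I01 q (RL_integral \<alpha> h) < e" by simp
  qed
qed

lemma RL_integral_unit_ball_totally_bounded:
  assumes p: "1 \<le> p" and pq: "ereal p \<le> q" and a: "1 / ereal p - 1 / q < ereal a0"
  shows "Metric_space.mtotally_bounded (Lp I01 q) (Lp_dist I01 q)
    {Lp_class I01 q (RL_integral \<alpha> f) | f. f \<in> lp_space I01 (ereal p) \<and> lp_norm I01 (ereal p) f \<le> 1}"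
    (is "Metric_space.mtotally_bounded _ _ ?S")
proof -
  have p1: "1 \<le> ereal p" using p by (simp add: one_ereal_def)
  have q1: "1 \<le> q" using p1 pq by (rule order_trans)
  let ?A = "{f \<in> lp_space I01 (ereal p). lp_norm I01 (ereal p) f \<le> 1}"
  let ?P = "\<lambda>f. Lp_class I01 q (RL_integral \<alpha> f)"
  note T = RL_integral_in_lp_space[OF assms]
  have S: "?S = ?P ` ?A" by auto
  show ?thesis
    unfolding S
  proof (rule mtotally_bounded_image_by_codes[OF Metric_space_Lp[OF q1]])
    show "?P ` ?A \<subseteq> Lp I01 q" using T by (auto intro!: Lp_class_in_Lp)
    fix e :: real assume "0 < e"
    then obtain n \<delta> where \<delta>: "0 < \<delta>" and small: "\<And>h. h \<in> lp_space I01 (ereal p) \<Longrightarrow> lp_norm I01 (ereal p) h \<le> 2 \<Longrightarrow>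
        (\<And>j. j \<le> n \<Longrightarrow> \<bar>cell_integral n h j\<bar> \<le> \<delta>) \<Longrightarrow> lp_norm I01 q (RL_integral \<alpha> h) < e"
      using RL_integral_norm_small[OF p pq a, of 2 e] by auto
    \<comment> \<open>The code of \<open>f\<close> consists of its cell integrals, rounded to multiples of \<open>\<delta>\<close>.\<close>
    define c where "c f = restrict (\<lambda>j. \<lfloor>cell_integral n f j / \<delta>\<rfloor>) {..n}" for f
    have "c ` ?A \<subseteq> (\<Pi>\<^sub>E j\<in>{..n}. {\<lfloor>- 1 / \<delta>\<rfloor>..\<lfloor>1 / \<delta>\<rfloor>})"
    proof (rule image_subsetI)
      fix f assume f: "f \<in> ?A"
      then have "\<bar>cell_integral n f j\<bar> \<le> 1" for j
        using cell_integral_le[of f n j] I01.lp_space_integrable[OF p1, of f] by fastforce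
      then have "- 1 / \<delta> \<le> cell_integral n f j / \<delta> \<and> cell_integral n f j / \<delta> \<le> 1 / \<delta>" for j
        using \<delta> by (intro conjI divide_right_mono) (auto simp: abs_le_iff minus_le_iff)
      then show "c f \<in> (\<Pi>\<^sub>E j\<in>{..n}. {\<lfloor>- 1 / \<delta>\<rfloor>..\<lfloor>1 / \<delta>\<rfloor>})"
        unfolding c_def PiE_iff by (metis (no_types, lifting) atLeastAtMost_iff floor_mono restrict_apply restrict_extensional)
    qed
    then have fin: "finite (c ` ?A)"
      by (rule finite_subset) (auto intro: finite_PiE)
    have close: "Lp_dist I01 q (?P f) (?P g) < e" if f: "f \<in> ?A" and g: "g \<in> ?A" and eq: "c f = c g" for f g
    proof -
      let ?h = "\<lambda>x. f x - g x"
      have h: "?h \<in> lp_space I01 (ereal p)" "lp_norm I01 (ereal p) ?h \<le> 2"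
        using lp_space_diff[OF p1, of f I01 g] f g by auto
      have int: "integrable I01 f" "integrable I01 g"
        using f g I01.lp_space_integrable[OF p1] by auto
      have "lp_norm I01 q (RL_integral \<alpha> ?h) < e"
      proof (rule small[OF h])
        fix j assume "j \<le> n"
        then have "\<lfloor>cell_integral n f j / \<delta>\<rfloor> = \<lfloor>cell_integral n g j / \<delta>\<rfloor>"
          using fun_cong[OF eq, of j] by (simp add: c_def)
        then have "\<bar>cell_integral n f j / \<delta> - cell_integral n g j / \<delta>\<bar> \<le> 1" by linarith
        then show "\<bar>cell_integral n ?h j\<bar> \<le> \<delta>"
          using \<delta> by (simp add: cell_integral_diff[OF int] diff_divide_distrib[symmetric] abs_divide)
      qed
      moreover have "lp_norm I01 q (RL_integral \<alpha> ?h) = lp_norm I01 q (\<lambda>t. RL_integral \<alpha> f t - RL_integral \<alpha> g t)"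
      proof (rule lp_norm_cong_AE)
        show "RL_integral \<alpha> ?h \<in> borel_measurable I01"
          using h by (intro RL_integral_measurable lp_space_measurable)
        show "(\<lambda>t. RL_integral \<alpha> f t - RL_integral \<alpha> g t) \<in> borel_measurable I01"
          using int by (intro borel_measurable_diff RL_integral_measurable) auto
        show "AE t in I01. RL_integral \<alpha> ?h t = RL_integral \<alpha> f t - RL_integral \<alpha> g t"
          using RL_integral_linear_AE[OF int, of 1 "-1"] by simp
      qed
      ultimately show ?thesis using f g T by (simp add: Lp_dist_class[OF q1])
    qed
    show "\<exists>c::(real \<Rightarrow> real) \<Rightarrow> nat \<Rightarrow> int. finite (c ` ?A) \<and> (\<forall>f\<in>?A. \<forall>g\<in>?A. c f = c g \<longrightarrow> Lp_dist I01 q (?P f) (?P g) < e)"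
      using fin close by (intro exI[of _ c] conjI ballI impI)
  qed
qed

lemma compact_operator_RL_integral:
  assumes p: "1 \<le> p" and pq: "ereal p \<le> q" and a: "1 / ereal p - 1 / q < ereal a0"
  shows "compact_operator_Lp I01 (ereal p) I01 q (RL_integral \<alpha>)"
proof -
  have p1: "1 \<le> ereal p" using p by (simp add: one_ereal_def)
  have q1: "1 \<le> q" using p1 pq by (rule order_trans)
  note T = RL_integral_in_lp_space[OF assms]
  note int = I01.lp_space_integrable(1)[OF p1]
  interpret X: Metric_space "Lp I01 q" "Lp_dist I01 q" by (rule Metric_space_Lp[OF q1])
  have cong: "AE t in I01. RL_integral \<alpha> f t = RL_integral \<alpha> g t"
    if "f \<in> lp_space I01 (ereal p)" "g \<in> lp_space I01 (ereal p)" "AE t in I01. f t = g t" for f g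
  proof (rule AE_I2)
    fix t assume "t \<in> space I01"
    then have t: "t \<in> {0..1}" by (simp add: space_restrict_space)
    note [measurable] = lp_space_measurable[OF that(1)] lp_space_measurable[OF that(2)]
    show "RL_integral \<alpha> f t = RL_integral \<alpha> g t"
      unfolding RL_integral_eq[OF t] using that(3) by (intro integral_cong_AE) auto
  qed
  show ?thesis
    unfolding compact_operator_Lp_def Let_def
  proof (intro conjI ballI allI impI)
    show "RL_integral \<alpha> f \<in> lp_space I01 q" if "f \<in> lp_space I01 (ereal p)" for f
      using that by (rule T)
    show "(RL_integral \<alpha> f, RL_integral \<alpha> g) \<in> ae_eq I01 q" if "(f, g) \<in> ae_eq I01 (ereal p)" for f g
      using that T cong by (auto simp: ae_eq_def)
    show "AE t in I01. RL_integral \<alpha> (\<lambda>x. a * f x + b * g x) t = a * RL_integral \<alpha> f t + b * RL_integral \<alpha> g t"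
      if "f \<in> lp_space I01 (ereal p)" "g \<in> lp_space I01 (ereal p)" for f g a b
      using that by (intro RL_integral_linear_AE int)
    show "compactin X.mtopology (X.mtopology closure_of
      {Lp_class I01 q (RL_integral \<alpha> f) |f. f \<in> lp_space I01 (ereal p) \<and> lp_norm I01 (ereal p) f \<le> 1})"
      using RL_integral_unit_ball_totally_bounded[OF assms]
        X.mtotally_bounded_eq_compact_closure_of[OF I01.mcomplete_Lp[OF q1]] by blast
  qed
qed

end

text \<open>Over a probability space, compactness from \<open>L\<^sub>r\<close> implies compactness from the smaller space
  \<open>L\<^sub>p\<close>, \<open>r \<le> p\<close>.\<close>

lemma (in prob_space) compact_operator_Lp_antimono:
  assumes T: "compact_operator_Lp M r N q T" and p: "1 \<le> r" "r \<le> p" and q: "1 \<le> q"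
  shows "compact_operator_Lp M p N q T"
proof -
  interpret X: Metric_space "Lp N q" "Lp_dist N q" by (rule Metric_space_Lp[OF q])
  note sub = lp_space_antimono(1)[OF p] and norm = lp_space_antimono(2)[OF p]
  let ?S = "\<lambda>p. {Lp_class N q (T f) |f. f \<in> lp_space M p \<and> lp_norm M p f \<le> 1}"
  have "?S p \<subseteq> ?S r" using sub norm by fastforce
  then have "X.mtopology closure_of ?S p \<subseteq> X.mtopology closure_of ?S r" by (rule closure_of_mono)
  moreover have "compactin X.mtopology (X.mtopology closure_of ?S r)"
    using T by (simp add: compact_operator_Lp_def Let_def)
  ultimately have "compactin X.mtopology (X.mtopology closure_of ?S p)"
    using closed_compactin closedin_closure_of by blast
  moreover have "(T f, T g) \<in> ae_eq N q" if "(f, g) \<in> ae_eq M p" for f g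
    using T that sub unfolding compact_operator_Lp_def by (auto simp: ae_eq_def)
  ultimately show ?thesis
    using T sub unfolding compact_operator_Lp_def Let_def by blast
qed

theorem proposition5p1:
  fixes p q :: ereal and \<alpha> :: "real \<Rightarrow> real"
  assumes "1 \<le> p" and "1 \<le> q"
    and "\<alpha> \<in> borel_measurable (lebesgue_on {0..1})"
    and "\<And>t. t \<in> {0..1} \<Longrightarrow> 0 \<le> \<alpha> t"
    and "ereal (INF t\<in>{0..1}. \<alpha> t) > max (1 / p - 1 / q) 0"
  shows "compact_operator_Lp (lebesgue_on {0..1}) p (lebesgue_on {0..1}) q (RL_integral \<alpha>)"
proof -
  define a0 where "a0 = (INF t\<in>{0..1}. \<alpha> t)"
  have a0: "0 < a0" "1 / p - 1 / q < ereal a0" using assms(5) by (auto simp: a0_def)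
  have "bdd_below (\<alpha> ` {0..1})" using assms(4) by (auto intro!: bdd_belowI[of _ 0])
  then have "a0 \<le> \<alpha> t" if "t \<in> {0..1}" for t
    unfolding a0_def using that by (rule cINF_lower)
  then interpret RL_order \<alpha> a0
    using assms(3) a0(1) by unfold_locales auto
  \<comment> \<open>A finite exponent \<open>r \<le> min p q\<close> for which the hypothesis on the order still holds.\<close>
  obtain r where r: "1 \<le> r" "ereal r \<le> p" "ereal r \<le> q" "1 / ereal r - 1 / q < ereal a0"
  proof (cases q)
    case (real s)
    then have s: "1 \<le> s" using assms(2) by (simp add: one_ereal_def)
    show thesis
    proof (cases "p \<le> q")
      case True
      then obtain r where "p = ereal r" using assms(1) real by (cases p) auto
      then show thesis using that[of r] True assms(1) a0(2) by (simp add: one_ereal_def)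
    next
      case False
      then show thesis using that[of s] s real a0(1) by (simp add: one_ereal_def)
    qed
  next
    case PInf
    show thesis
    proof (cases p)
      case (real r)
      then show thesis using that[of r] assms(1) a0(2) PInf by (simp add: one_ereal_def)
    next
      case PInf': PInf
      define r where "r = max 1 (2 / a0)"
      have "1 \<le> r" by (simp add: r_def)
      have "1 / r \<le> 1 / (2 / a0)" using a0(1) by (intro divide_left_mono) (auto simp: r_def)
      then have "1 / r < a0" using a0(1) by simp
      then show thesis using that[of r] PInf PInf' \<open>1 \<le> r\<close> by (simp add: one_ereal_def)
    qed (use assms(1) in simp)
  qed (use assms(2) in simp)
  have "compact_operator_Lp I01 (ereal r) I01 q (RL_integral \<alpha>)"
    by (rule compact_operator_RL_integral[OF r(1,3,4)])
  then show ?thesis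
    by (rule I01.compact_operator_Lp_antimono[OF _ _ r(2) assms(2)])
      (use r(1) in \<open>simp add: one_ereal_def\<close>)
qed

end
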